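(* A passport of a bicolored $2$-Platonic graph that is also a uniform graph (of the same type) is realizable if and only if, up to a permutation of its three partitions, it is of the form $$\left((k^* ),(m^* ),(l^*,(ls)^2),\,n(k,m,l)\cdot s\right)\quad\text{or}\quad\left((k^* ),(m^*,ms),(l^*,ls),\,n(k,m,l)\cdot s\right),$$ where $(k,m,l)$ is a Platonic triple and $s\ge 2$ is an integer. Equivalently: a passport is the passport of some bicolored graph that is $2$-Platonic of some type and uniform of the same type if and only if, up to a permutation of its three partitions, it has one of these two forms.
   Context: A bicolored graph is a finite connected plane graph (embedded in the sphere), with at least one edge and possibly multiple edges, whose vertices are colored black and white so that every edge joins a black and a white vertex. The passport of a bicolored graph with $n$ edges is $(\Pi_1,\Pi_2,\Pi_3,n)$, where $\Pi_1$ is the partition of $n$ given by the degrees of the black vertices, $\Pi_2$ the one given by the degrees of the white vertices, and $\Pi_3$ the one given by the face degrees divided by two (an edge having the same face on both sides is counted twice in the face degree). In general, a passport is a collection $(\Pi_1,\Pi_2,\Pi_3,n)$ of three partitions of $n$ whose total number of parts is $n+2$; it is realizable if it is the passport of some bicolored graph (equivalently, of a rational function with critical values in $\{0,1,\infty\}$ whose multiplicities over $0,1,\infty$ are $\Pi_1,\Pi_2,\Pi_3$). Notation in passports: $a^j$ is a string of $j$ entries equal to $a$; $a^*$ is a string of entries equal to $a$ whose (possibly zero) number is determined by the requirement that the collection be a passport. Thus $(ls)^2$ means two entries equal to $ls$. A triple of integers $k,m,l\ge2$ is Platonic if $\frac1k+\frac1m+\frac1l>1$. For such a triple there is a unique bicolored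 graph with passport $(k^*,m^*,l^* )$, i.e. with all parts of the three partitions equal to $k$, $m$, $l$ respectively; $n(k,m,l)$ is its number of edges (equivalently, the degree of its Belyi function), so $n(k,m,l)=2/(\frac1k+\frac1m+\frac1l-1)$. A bicolored graph is uniform of type $(k,m,l)$, where $k,m,l\ge2$, if all parts of $\Pi_1,\Pi_2,\Pi_3$ are divisible by $k,m,l$ respectively. It is $2$-Platonic of type $(k,m,l)$ if all parts of $\Pi_1,\Pi_2,\Pi_3$ equal $k,m,l$ respectively, with exactly two exceptions in total (parts different from the prescribed value), which may lie in the same partition or in two different partitions. By convention, the Platonic graph of type $(2,2,r)$, with passport $((2^r),(2^r),(r^2),2r)$, is not considered as a $2$-Platonic graph of type $(2,2,m)$ when $r$ is not divisible by $m$. *)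

theory Defs
  imports Complex_Main "HOL-Library.Multiset" "HOL-Combinatorics.Orbits"
    "Graph_Theory.Digraph" "Graph_Theory.Digraph_Component"
begin

text \<open>
  A plane graph is encoded by its rotation system: the map \<open>rot v\<close> sends an edge at \<open>v\<close>
  to the next one in the counterclockwise cyclic order of the edges around \<open>v\<close>.  A
  connected graph with such a rotation system has a cellular embedding, unique up to
  orientation-preserving homeomorphism, in a closed oriented surface; its faces are the
  orbits of the face-tracing map below, and the surface is the sphere iff the Euler
  characteristic \<open>V - E + F\<close> is 2.

  Multiple edges are allowed.  Every edge is directed from its black end (\<open>tail\<close>) to its
  white end (\<open>head\<close>); this orientation carries no information beyond the colours.
\<close>

type_synonym passport = "nat multiset \<times> nat multiset \<times> nat multiset \<times> nat"

definition edges_at :: "('v, 'e) pre_digraph \<Rightarrow> 'v \<Rightarrow> 'e set" where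
  "edges_at G v = out_arcs G v \<union> in_arcs G v"

text \<open>
  A side of an edge is identified with a direction of traversal, \<open>(e, True)\<close> from black to
  white and \<open>(e, False)\<close> from white to black: the side is the one on the right of the
  traveller.  The next side on the boundary of the same face is obtained by turning into the
  next edge, in counterclockwise order, around the vertex that has been reached.
\<close>

definition face_succ ::
    "('v, 'e) pre_digraph \<Rightarrow> ('v \<Rightarrow> 'e \<Rightarrow> 'e) \<Rightarrow> 'e \<times> bool \<Rightarrow> 'e \<times> bool" where
  "face_succ G rot = (\<lambda>(e, to_white).
     if to_white then (rot (head G e) e, False) else (rot (tail G e) e, True))"

text \<open>
  A face is the set of edge sides on its boundary, so an edge with the same face on both
  sides contributes 2 to the cardinality of that face.
\<close>

definition faces ::
    "('v, 'e) pre_digraph \<Rightarrow> ('v \<Rightarrow> 'e \<Rightarrow> 'e) \<Rightarrow> ('e \<times> bool) set set" where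
  "faces G rot = orbit (face_succ G rot) ` (arcs G \<times> UNIV)"

locale bicolored_graph = fin_digraph G
  for G :: "('v, 'e) pre_digraph" (structure) +
  fixes black :: "'v set"
    and rot :: "'v \<Rightarrow> 'e \<Rightarrow> 'e"
  assumes black_verts: "black \<subseteq> verts G"
    and tail_black: "e \<in> arcs G \<Longrightarrow> tail G e \<in> black"
    and head_white: "e \<in> arcs G \<Longrightarrow> head G e \<notin> black"
    and arcs_nonempty: "arcs G \<noteq> {}"
    and connected: "Digraph_Component.connected G"
    and rot_cyclic: "v \<in> verts G \<Longrightarrow> cyclic_on (rot v) (edges_at G v)"
    and euler_sphere:
      "int (card (verts G)) - int (card (arcs G)) + int (card (faces G rot)) = 2"
begin

definition white :: "'v set" where
  "white = verts G - black"

definition black_partition :: "nat multiset" where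
  "black_partition = image_mset (\<lambda>v. card (edges_at G v)) (mset_set black)"

definition white_partition :: "nat multiset" where
  "white_partition = image_mset (\<lambda>v. card (edges_at G v)) (mset_set white)"

definition face_partition :: "nat multiset" where
  "face_partition = image_mset (\<lambda>f. card f div 2) (mset_set (faces G rot))"

definition passport :: passport where
  "passport = (black_partition, white_partition, face_partition, card (arcs G))"

definition uniform :: "nat \<Rightarrow> nat \<Rightarrow> nat \<Rightarrow> bool" where
  "uniform k m l \<longleftrightarrow> k \<ge> 2 \<and> m \<ge> 2 \<and> l \<ge> 2 \<and>
     (\<forall>x \<in># black_partition. k dvd x) \<and>
     (\<forall>x \<in># white_partition. m dvd x) \<and>
     (\<forall>x \<in># face_partition. l dvd x)"

text \<open>
  The last conjunct is the convention that the Platonic graph of type \<open>(2,2,r)\<close> is not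
  2-Platonic of type \<open>(2,2,t)\<close> when \<open>t\<close> does not divide \<open>r\<close>; pairing every partition with
  its prescribed value expresses it for all orders of the three entries at once.
\<close>

definition two_platonic :: "nat \<Rightarrow> nat \<Rightarrow> nat \<Rightarrow> bool" where
  "two_platonic k m l \<longleftrightarrow> k \<ge> 2 \<and> m \<ge> 2 \<and> l \<ge> 2 \<and>
     size {#x \<in># black_partition. x \<noteq> k#} + size {#x \<in># white_partition. x \<noteq> m#}
       + size {#x \<in># face_partition. x \<noteq> l#} = 2 \<and>
     \<not> (\<exists>r t. r \<ge> 2 \<and> \<not> t dvd r \<and>
          {#(k, black_partition), (m, white_partition), (l, face_partition)#} =
          {#(2, replicate_mset r 2), (2, replicate_mset r 2), (t, replicate_mset 2 r)#})"

end

definition is_partition :: "nat multiset \<Rightarrow> nat \<Rightarrow> bool" where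
  "is_partition P n \<longleftrightarrow> (\<forall>x \<in># P. 0 < x) \<and> sum_mset P = n"

fun is_passport :: "passport \<Rightarrow> bool" where
  "is_passport (P1, P2, P3, n) \<longleftrightarrow>
     is_partition P1 n \<and> is_partition P2 n \<and> is_partition P3 n \<and>
     size P1 + size P2 + size P3 = n + 2"

definition platonic :: "nat \<Rightarrow> nat \<Rightarrow> nat \<Rightarrow> bool" where
  "platonic k m l \<longleftrightarrow> k \<ge> 2 \<and> m \<ge> 2 \<and> l \<ge> 2 \<and> 1 / real k + 1 / real m + 1 / real l > 1"

text \<open>
  The number of edges of the bicolored graph with passport \<open>(k\<^sup>*, m\<^sup>*, l\<^sup>*)\<close>, meaningful for
  Platonic triples only.  By Euler's formula it equals \<open>2 / (1/k + 1/m + 1/l - 1)\<close>.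
\<close>

definition platonic_edges :: "nat \<Rightarrow> nat \<Rightarrow> nat \<Rightarrow> nat" where
  "platonic_edges k m l = (THE n. \<exists>(G :: (nat, nat) pre_digraph) black rot a b c.
     bicolored_graph G black rot \<and>
     bicolored_graph.passport G black rot =
       (replicate_mset a k, replicate_mset b m, replicate_mset c l, n))"

end

theory Submission
  imports Defs
begin

text \<open>
  A bicolored graph with edge set \<open>A\<close> is the same as a transitive pair of permutations of \<open>A\<close>,
  a constellation \<open>(a, b)\<close>: \<open>a\<close> rotates the edges around their black ends, \<open>b\<close> around their white
  ends, and the cycles of \<open>a \<circ> b\<close> are the faces.  The three partitions of the passport are the
  cycle types of \<open>a\<close>, \<open>b\<close> and \<open>a \<circ> b\<close>, and the graph is plane iff these permutations have
  \<open>card A + 2\<close> cycles in total, the largest number possible (\<open>constellation_genus\<close>).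

  Necessity.  Let the graph be uniform of type \<open>(k, m, l)\<close> with two exceptional parts, and let
  \<open>\<chi> = 1/k + 1/m + 1/l - 1\<close>.  Counting cycles gives \<open>n \<chi> = 2 + \<Sum> (x/h - 1) > 0\<close>, where the
  sum runs over the exceptional parts \<open>x\<close>, with \<open>h\<close> the prescribed value; so the type is Platonic.
  Let \<open>F\<close> be the Platonic constellation of that type, which has \<open>2 / \<chi>\<close> edges.  In topological
  terms, uniformity says that the rational function of the graph factors through the orbifold
  universal cover \<open>F\<close>.  Combinatorially, an orbit \<open>C\<close> of the product action on \<open>E \<times> F\<close> covers \<open>E\<close>
  without ramification, because every cycle length of \<open>F\<close> divides the corresponding ones of \<open>E\<close>.
  An unramified cover of degree \<open>N\<close> of the sphere has Euler characteristic \<open>2 N\<close>, which cannot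
  exceed 2; hence \<open>C\<close> is the graph of an equivariant map \<open>E \<rightarrow> F\<close> (\<open>planar_lifting\<close>).  If its
  degree is \<open>s\<close>, then \<open>n = s n(k,m,l)\<close> and no cycle of \<open>E\<close> is longer than \<open>s\<close> times the cycle of
  \<open>F\<close> below it.  The counting formula becomes \<open>\<Sum> (x/h - 1) = 2 (s - 1)\<close> over two exceptional
  parts \<open>x \<le> s h\<close>, so both of them equal \<open>s h\<close> (\<open>uniform_exceptions\<close>).

  Sufficiency.  Over any two vertices or faces of a constellation there is a cyclic cover of any
  degree \<open>s\<close>, totally ramified over these two and unramified elsewhere (\<open>cyclic_cover\<close>).  It is given
  by a cocycle with values in \<open>\<int>/s\<close> that sums to \<open>1\<close> and \<open>-1\<close> around the two places and to \<open>0\<close>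
  around all others; elementary cocycles do this for places that share an edge, and connectedness
  does the rest.  Applied to a Platonic constellation it yields the required passports.  The same
  covers also produce the Platonic constellations themselves, from their small quotients by the
  rotations about an axis (\<open>platonic_exists\<close>).
\<close>

section \<open>Permutations of a finite set and their orbits\<close>

text \<open>
  A permutation is any function that restricts to a bijection of the carrier; its values outside
  are irrelevant, so that restrictions to invariant subsets and products need no adjustment.
\<close>

definition perm_on :: "'a set \<Rightarrow> ('a \<Rightarrow> 'a) \<Rightarrow> bool" where
  "perm_on A p \<longleftrightarrow> finite A \<and> bij_betw p A A"

lemma perm_onI:
  assumes "finite A" "\<And>x. x \<in> A \<Longrightarrow> p x \<in> A" "inj_on p A"
  shows "perm_on A p"
  using assms endo_inj_surj[of A p] unfolding perm_on_def bij_betw_def by blast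

lemma perm_on_in: "perm_on A p \<Longrightarrow> x \<in> A \<Longrightarrow> p x \<in> A"
  unfolding perm_on_def by (meson bij_betwE)

lemma perm_on_inj: "perm_on A p \<Longrightarrow> inj_on p A"
  unfolding perm_on_def by (simp add: bij_betw_def)

lemma perm_on_finite: "perm_on A p \<Longrightarrow> finite A"
  unfolding perm_on_def by simp

lemma perm_on_comp: "perm_on A p \<Longrightarrow> perm_on A q \<Longrightarrow> perm_on A (p \<circ> q)"
  unfolding perm_on_def by (auto intro: bij_betw_trans)

lemma perm_on_invariant:
  assumes "perm_on A p" "S \<subseteq> A" "\<And>x. x \<in> S \<Longrightarrow> p x \<in> S"
  shows "perm_on S p"
proof (rule perm_onI)
  show "finite S" using assms(2) perm_on_finite[OF assms(1)] finite_subset by blast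
  show "inj_on p S" using perm_on_inj[OF assms(1)] assms(2) inj_on_subset by blast
qed (rule assms(3))

text \<open>
  By finiteness an invariant subset is mapped onto itself, so no point from outside can enter it.
\<close>

lemma perm_on_invariant_iff:
  assumes "perm_on A p" "S \<subseteq> A" "\<And>x. x \<in> S \<Longrightarrow> p x \<in> S" "x \<in> A"
  shows "p x \<in> S \<longleftrightarrow> x \<in> S"
proof
  assume "p x \<in> S"
  have "p ` S = S" using perm_on_invariant[OF assms(1-3)] by (simp add: perm_on_def bij_betw_def)
  then obtain y where "y \<in> S" "p x = p y" using \<open>p x \<in> S\<close> by (metis imageE)
  then show "x \<in> S" using perm_on_inj[OF assms(1)] assms(2,4) by (metis inj_onD subsetD)
qed (rule assms(3))

inductive_set joint :: "('a \<Rightarrow> 'a) \<Rightarrow> ('a \<Rightarrow> 'a) \<Rightarrow> 'a \<Rightarrow> 'a set" for a b x where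
  base: "x \<in> joint a b x"
| left: "y \<in> joint a b x \<Longrightarrow> a y \<in> joint a b x"
| right: "y \<in> joint a b x \<Longrightarrow> b y \<in> joint a b x"

lemma joint_least:
  assumes "x \<in> S" "\<And>y. y \<in> S \<Longrightarrow> a y \<in> S" "\<And>y. y \<in> S \<Longrightarrow> b y \<in> S"
  shows "joint a b x \<subseteq> S"
proof
  fix y assume "y \<in> joint a b x" then show "y \<in> S" by induct (auto intro: assms)
qed

lemma joint_trans: "y \<in> joint a b x \<Longrightarrow> joint a b y \<subseteq> joint a b x"
  by (rule joint_least) (auto intro: joint.intros)

lemma joint_subset:
  "perm_on A a \<Longrightarrow> perm_on A b \<Longrightarrow> x \<in> A \<Longrightarrow> joint a b x \<subseteq> A"
  by (rule joint_least) (auto intro: perm_on_in)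

text \<open>
  Closure under the permutations alone is enough for symmetry: the complement of the joint orbit
  of \<open>y\<close> is invariant, so if it contained \<open>x\<close>, it would contain \<open>y\<close>.
\<close>

lemma joint_sym:
  assumes "perm_on A a" "perm_on A b" "x \<in> A" "y \<in> joint a b x"
  shows "x \<in> joint a b y"
proof (rule ccontr)
  let ?S = "joint a b y"
  assume x: "x \<notin> ?S"
  have S: "?S \<subseteq> A" using joint_subset assms by (metis subsetD)
  have "joint a b x \<subseteq> A - ?S"
  proof (rule joint_least)
    show "x \<in> A - ?S" using x assms by simp
    fix z assume z: "z \<in> A - ?S"
    show "a z \<in> A - ?S"
      using perm_on_invariant_iff[OF assms(1) S, of z] z perm_on_in[OF assms(1)] joint.left by fast
    show "b z \<in> A - ?S"
      using perm_on_invariant_iff[OF assms(2) S, of z] z perm_on_in[OF assms(2)] joint.right by fast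
  qed
  then show False using assms(4) joint.base by fast
qed

lemma joint_eq:
  assumes "perm_on A a" "perm_on A b" "x \<in> A" "y \<in> joint a b x"
  shows "joint a b y = joint a b x"
  using joint_trans[OF assms(4)] joint_trans[OF joint_sym[OF assms]] by blast

lemma orbit_subset_joint:
  assumes "\<And>y. y \<in> joint a b x \<Longrightarrow> p y \<in> joint a b x"
  shows "orbit p x \<subseteq> joint a b x"
proof
  fix y assume "y \<in> orbit p x" then show "y \<in> joint a b x"
    by induct (auto intro: assms joint.base)
qed

lemma orbit_eq_joint:
  assumes "perm_on A p" "x \<in> A"
  shows "orbit p x = joint p p x"
proof
  show "orbit p x \<subseteq> joint p p x" by (rule orbit_subset_joint) (rule joint.left)
  have "x \<in> joint p p (p x)"
    using joint_sym[OF assms(1,1,2) joint.left[OF joint.base]] .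
  moreover have "joint p p (p x) \<subseteq> orbit p x"
    by (rule joint_least) (auto intro: orbit.intros)
  ultimately have "x \<in> orbit p x" by blast
  then show "joint p p x \<subseteq> orbit p x"
    by (rule joint_least) (auto intro: orbit.intros)
qed

lemma self_in_orbit: "perm_on A p \<Longrightarrow> x \<in> A \<Longrightarrow> x \<in> orbit p x"
  by (simp add: orbit_eq_joint joint.base)

lemma orbit_in: "perm_on A p \<Longrightarrow> x \<in> A \<Longrightarrow> orbit p x \<subseteq> A"
  by (simp add: orbit_eq_joint joint_subset)

lemma orbit_eq:
  assumes "perm_on A p" "x \<in> A" "y \<in> orbit p x"
  shows "orbit p y = orbit p x"
  using assms orbit_in[OF assms(1,2)] joint_eq[OF assms(1,1,2)]
  by (auto simp: orbit_eq_joint)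

lemma finite_orbit_on: "perm_on A p \<Longrightarrow> x \<in> A \<Longrightarrow> finite (orbit p x)"
  using finite_subset orbit_in perm_on_finite by metis

lemma card_orbit_pos: "perm_on A p \<Longrightarrow> x \<in> A \<Longrightarrow> card (orbit p x) > 0"
  using finite_orbit_on orbit_nonempty card_gt_0_iff by metis

section \<open>The genus inequality\<close>

definition ncyc :: "'a set \<Rightarrow> ('a \<Rightarrow> 'a) \<Rightarrow> nat" where
  "ncyc A p = card (orbit p ` A)"

definition njoint :: "'a set \<Rightarrow> ('a \<Rightarrow> 'a) \<Rightarrow> ('a \<Rightarrow> 'a) \<Rightarrow> nat" where
  "njoint A a b = card (joint a b ` A)"

lemma ncyc_eq_njoint: "perm_on A p \<Longrightarrow> ncyc A p = njoint A p p"
  unfolding ncyc_def njoint_def by (simp add: orbit_eq_joint cong: image_cong_simp)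

lemma card_image_coarser:
  assumes "finite B" "\<And>u v. u \<in> B \<Longrightarrow> v \<in> B \<Longrightarrow> S u = S v \<Longrightarrow> R u = R v"
  shows "card (R ` B) \<le> card (S ` B)"
proof -
  define g where "g C = R (SOME u. u \<in> B \<and> S u = C)" for C
  have "g (S u) = R u" if "u \<in> B" for u
  proof -
    have "(SOME w. w \<in> B \<and> S w = S u) \<in> B \<and> S (SOME w. w \<in> B \<and> S w = S u) = S u"
      by (rule someI[of _ u]) (use that in simp)
    then show ?thesis unfolding g_def using assms(2) that by metis
  qed
  then have "R ` B = g ` S ` B" by (force simp: image_iff)
  then show ?thesis using assms(1) by (simp add: card_image_le)
qed

lemma card_classes_antimono:
  assumes "finite A" "\<And>u. u \<in> A \<Longrightarrow> u \<in> R u"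
    and "\<And>u v. u \<in> A \<Longrightarrow> v \<in> R u \<Longrightarrow> S v = S u"
  shows "card (S ` A) \<le> card (R ` A)"
  using assms by (intro card_image_coarser) metis+

text \<open>
  Gluing two classes \<open>R x\<close> and \<open>R y\<close> loses at most one class: away from \<open>R y\<close>, distinct
  \<open>R\<close>-classes lie in distinct \<open>S\<close>-classes.
\<close>

lemma card_classes_merge:
  assumes "finite A" "x \<in> A" "y \<in> A"
    and "\<And>u. u \<in> A \<Longrightarrow> u \<in> S u"
    and "\<And>u v. u \<in> A \<Longrightarrow> v \<in> R u \<Longrightarrow> R v = R u"
    and "\<And>u v. u \<in> A \<Longrightarrow> v \<in> A \<Longrightarrow> S u = S v \<Longrightarrow>
        R u = R v \<or> (R u = R x \<or> R u = R y) \<and> (R v = R x \<or> R v = R y)"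
  shows "card (R ` A) \<le> card (S ` A) + 1"
proof -
  define B where "B = {u \<in> A. R u \<noteq> R y}"
  have "card (R ` B) \<le> card (S ` B)"
  proof (rule card_image_coarser)
    show "finite B" unfolding B_def using assms(1) by simp
    fix u v assume "u \<in> B" "v \<in> B" "S u = S v"
    then show "R u = R v" using assms(6)[of u v] unfolding B_def mem_Collect_eq by metis
  qed
  also have "\<dots> \<le> card (S ` A)"
    by (rule card_mono) (use assms(1) in \<open>auto simp: B_def\<close>)
  finally have "card (R ` B) \<le> card (S ` A)" .
  moreover have "R ` A = insert (R y) (R ` B)" unfolding B_def using assms(3) by auto
  moreover have "card (insert (R y) (R ` B)) \<le> card (R ` B) + 1"
    by (cases "finite (R ` B)") (simp_all add: card_insert_if)
  ultimately show ?thesis by simp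
qed

lemma perm_on_transpose: "finite A \<Longrightarrow> x \<in> A \<Longrightarrow> y \<in> A \<Longrightarrow> perm_on A (transpose x y)"
  by (rule perm_onI) (auto simp: transpose_def inj_on_def)

text \<open>
  Composing with a transposition glues two different cycles into one: the new permutation follows
  the \<open>p\<close>-cycle of \<open>x\<close> until it would return to \<open>x\<close>, and then jumps to \<open>y\<close>.
\<close>

lemma orbit_transpose_joins:
  assumes p: "perm_on A p" and xy: "x \<in> A" "y \<in> A" "y \<notin> orbit p x"
  shows "y \<in> orbit (transpose x y \<circ> p) x"
proof (rule ccontr)
  let ?q = "transpose x y \<circ> p"
  assume y: "y \<notin> orbit ?q x"
  have q: "perm_on A ?q"
    using perm_on_comp[OF perm_on_transpose p] xy perm_on_finite[OF p] by blast
  have "z \<in> orbit ?q x \<and> z \<noteq> x" if "z \<in> orbit p x" for z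
    using that
  proof induct
    case base
    have "?q x \<noteq> y" using y orbit.base[of ?q x] by metis
    then have "p x \<noteq> x" by auto
    moreover have "p x \<noteq> y" using xy(3) orbit.base by metis
    moreover have "?q x = p x" using \<open>p x \<noteq> x\<close> \<open>p x \<noteq> y\<close> by simp
    ultimately show ?case using orbit.base[of ?q x] by metis
  next
    case (step z)
    have "?q z \<in> orbit ?q x" using step orbit.step[of z ?q x] by blast
    then have "?q z \<noteq> y" using y by metis
    then have "p z \<noteq> x" by auto
    moreover have "p z \<noteq> y" using xy(3) orbit.step step by metis
    moreover have "?q z = p z" using \<open>p z \<noteq> x\<close> \<open>p z \<noteq> y\<close> by simp
    ultimately show ?case using \<open>?q z \<in> orbit ?q x\<close> by metis
  qed
  then show False using self_in_orbit[OF p xy(1)] by blast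
qed

lemma transpose_involution: "transpose x y \<circ> (transpose x y \<circ> p) = p"
  by (auto simp: fun_eq_iff)

text \<open>
  Inserting a transposition of two points of the same joint orbit does not leave joint orbits.
\<close>

lemma joint_respects:
  assumes "perm_on A c" "perm_on A d" "x \<in> A" "y \<in> A" "y \<in> joint c d x"
    and "\<And>z. z \<in> A \<Longrightarrow> a z = c z \<or> a z = transpose x y (c z)" 
    and "\<And>z. z \<in> A \<Longrightarrow> b z = d z \<or> b z = transpose x y (d z)"
    and "u \<in> A"
  shows "joint a b u \<subseteq> joint c d u"
proof -
  have xy: "x \<in> joint c d z \<longleftrightarrow> y \<in> joint c d z" if "z \<in> A" for z
  proof
    assume "x \<in> joint c d z"
    then show "y \<in> joint c d z" using joint_trans assms(5) by fast
  next
    assume "y \<in> joint c d z"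
    then show "x \<in> joint c d z" using joint_trans joint_sym[OF assms(1-3,5)] by fast
  qed
  have t: "transpose x y w \<in> joint c d u" if "w \<in> joint c d u" for w
    using that xy[OF assms(8)] by (metis transpose_eq_iff transpose_apply_other transpose_apply_first transpose_apply_second)
  have "a w \<in> joint c d u \<and> b w \<in> joint c d u" if "w \<in> joint c d u" for w
  proof -
    have "w \<in> A" using subsetD[OF joint_subset[OF assms(1,2,8)] that] .
    then have "a w = c w \<or> a w = transpose x y (c w)" "b w = d w \<or> b w = transpose x y (d w)"
      using assms(6,7) by blast+
    then show ?thesis using t[OF joint.left[OF that]] t[OF joint.right[OF that]]
        joint.left[OF that] joint.right[OF that] by auto
  qed
  then show ?thesis by (intro joint_least[where S = "joint c d u"]) (simp_all add: joint.base)
qed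

lemma joint_classes_refine:
  assumes "perm_on A a" "perm_on A b" "perm_on A c" "perm_on A d"
    and "\<And>u. u \<in> A \<Longrightarrow> joint a b u \<subseteq> joint c d u"
  shows "njoint A c d \<le> njoint A a b"
  unfolding njoint_def
proof (rule card_classes_antimono)
  show "finite A" using assms perm_on_finite by blast
  fix u v assume "u \<in> A" "v \<in> joint a b u"
  then show "joint c d v = joint c d u" using assms joint_eq by (metis subsetD)
next
  show "u \<in> joint a b u" for u by (rule joint.base)
qed

text \<open>
  Inserting a transposition into the generators loses at most one joint orbit: those that avoid the
  two transposed points do not change.
\<close>

lemma transposed_merge:
  assumes ab: "perm_on A a" "perm_on A b" and cd: "perm_on A c" "perm_on A d"
    and xy: "x \<in> A" "y \<in> A"
    and a: "\<And>z. z \<in> A \<Longrightarrow> a z = c z \<or> a z = transpose x y (c z)" 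
    and b: "\<And>z. z \<in> A \<Longrightarrow> b z = d z \<or> b z = transpose x y (d z)"
  shows "njoint A c d \<le> njoint A a b + 1"
  unfolding njoint_def
proof (rule card_classes_merge[where x = x and y = y])
  show "finite A" using ab perm_on_finite by blast
  fix u v assume uv: "u \<in> A" "v \<in> A" "joint a b u = joint a b v"
  let ?R = "joint c d"
  have ceq: "?R z = ?R w" if "z \<in> ?R w" "w \<in> A" for z w
    using that joint_eq[OF cd] by blast
  have sub: "w \<in> A" if "w \<in> ?R z" "z \<in> A" for w z using that joint_subset[OF cd] by blast
  show "?R u = ?R v \<or> (?R u = ?R x \<or> ?R u = ?R y) \<and> (?R v = ?R x \<or> ?R v = ?R y)"
  proof (cases "u \<in> ?R x \<union> ?R y")
    case True
    have T: "joint a b u \<subseteq> ?R x \<union> ?R y"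
    proof (rule joint_least[OF True])
      fix w assume w: "w \<in> ?R x \<union> ?R y"
      then have "w \<in> A" using sub xy by blast
      moreover have "c w \<in> ?R x \<union> ?R y" "d w \<in> ?R x \<union> ?R y"
        using w by (auto intro: joint.intros)
      moreover have "x \<in> ?R x" "y \<in> ?R y" by (auto intro: joint.base)
      ultimately show "a w \<in> ?R x \<union> ?R y" "b w \<in> ?R x \<union> ?R y"
        using a[of w] b[of w] unfolding transpose_def by (auto split: if_splits)
    qed
    then have "v \<in> ?R x \<union> ?R y" using uv(3) joint.base by fastforce
    then show ?thesis using True ceq xy by blast
  next
    case False
    have "joint a b u \<subseteq> ?R u"
    proof -
      have "joint a b u \<subseteq> {w \<in> ?R u. True}"
      proof (rule joint_least)
        fix w assume "w \<in> {w \<in> ?R u. True}"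
        then have w: "w \<in> ?R u" "w \<in> A" using sub uv by auto
        have "c w \<in> ?R u" "d w \<in> ?R u" using w by (auto intro: joint.intros)
        moreover have "x \<notin> ?R u" "y \<notin> ?R u" using False joint_sym[OF cd uv(1)] by blast+
        ultimately have "transpose x y (c w) = c w" "transpose x y (d w) = d w"
          by (metis transpose_apply_other)+
        then show "a w \<in> {w \<in> ?R u. True}" "b w \<in> {w \<in> ?R u. True}"
          using a[OF w(2)] b[OF w(2)] \<open>c w \<in> ?R u\<close> \<open>d w \<in> ?R u\<close> by auto
      qed (auto intro: joint.base)
      then show ?thesis by simp
    qed
    then have "v \<in> ?R u" using uv(3) joint.base by fastforce
    then show ?thesis using ceq uv(1) by metis
  qed
next
  fix u v assume "u \<in> A" "v \<in> joint c d u"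
  then show "joint c d v = joint c d u" using joint_eq[OF cd] by blast
next
  show "u \<in> joint a b u" for u by (rule joint.base)
  show "x \<in> A" "y \<in> A" by (fact xy)+
qed

lemma ncyc_transpose:
  assumes p: "perm_on A p" and xy: "x \<in> A" "y \<in> A"
  shows ncyc_transpose_le: "ncyc A p \<le> ncyc A (transpose x y \<circ> p) + 1"
    and ncyc_transpose_less:
      "y \<notin> orbit p x \<Longrightarrow> ncyc A (transpose x y \<circ> p) + 1 \<le> ncyc A p"
proof -
  let ?q = "transpose x y \<circ> p"
  have q: "perm_on A ?q"
    using perm_on_comp[OF perm_on_transpose p] xy perm_on_finite[OF p] by blast
  show "ncyc A p \<le> ncyc A ?q + 1"
    unfolding ncyc_eq_njoint[OF p] ncyc_eq_njoint[OF q]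
    by (rule transposed_merge[OF q q p p xy]) simp_all
  assume y: "y \<notin> orbit p x"
  have yq: "y \<in> joint ?q ?q x"
    using orbit_transpose_joins[OF p xy y] orbit_eq_joint[OF q xy(1)] by simp
  have sub: "joint p p u \<subseteq> joint ?q ?q u" if "u \<in> A" for u
    by (rule joint_respects[OF q q xy yq]) (use that in simp_all)
  \<comment> \<open>The orbits of the product are coarser, and strictly so: the orbit of \<open>y\<close> can be left out,
    because it is glued to that of \<open>x\<close>.\<close>
  have "joint ?q ?q ` A = joint ?q ?q ` {u \<in> A. joint p p u \<noteq> joint p p y}"
  proof -
    have 1: "joint ?q ?q u = joint ?q ?q x" if "u \<in> A" "joint p p u = joint p p y" for u
    proof -
      have "u \<in> joint p p y" using that joint.base by metis
      then have "u \<in> joint ?q ?q y" using sub xy by blast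
      then show ?thesis using yq joint_eq[OF q q] xy by metis
    qed
    have 2: "joint p p x \<noteq> joint p p y"
      using y orbit_eq_joint[OF p xy(1)] joint.base by metis
    have "joint ?q ?q u \<in> joint ?q ?q ` {u \<in> A. joint p p u \<noteq> joint p p y}" if "u \<in> A" for u
      using 1[OF that] 2 xy that by (cases "joint p p u = joint p p y") auto
    then show ?thesis by blast
  qed
  moreover have "card (joint ?q ?q ` {u \<in> A. joint p p u \<noteq> joint p p y})
      \<le> card (joint p p ` {u \<in> A. joint p p u \<noteq> joint p p y})"
  proof (rule card_classes_antimono)
    fix u v assume "u \<in> {u \<in> A. joint p p u \<noteq> joint p p y}" "v \<in> joint p p u"
    then show "joint ?q ?q v = joint ?q ?q u" using sub joint_eq[OF q q] by blast
  next
    show "finite {u \<in> A. joint p p u \<noteq> joint p p y}" using perm_on_finite[OF p] by simp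
    show "u \<in> joint p p u" for u by (rule joint.base)
  qed
  moreover have "joint p p ` {u \<in> A. joint p p u \<noteq> joint p p y} = joint p p ` A - {joint p p y}"
    by auto
  moreover have "card (joint p p ` A - {joint p p y}) + 1 = card (joint p p ` A)"
    using card_Suc_Diff1[of "joint p p ` A" "joint p p y"] xy perm_on_finite[OF p] by simp
  ultimately show "ncyc A ?q + 1 \<le> ncyc A p"
    unfolding ncyc_eq_njoint[OF p] ncyc_eq_njoint[OF q] njoint_def by simp
qed

text \<open>
  Induction on the number of points moved by \<open>a\<close>, splitting off the transposition \<open>(x, a x)\<close>.
  The permutation that remains has one cycle more than \<open>a\<close>.  If \<open>x\<close> and \<open>a x\<close> lie in one joint orbit of the remaining pair, the
  number of joint orbits does not drop, and the product gains at most one cycle.  Otherwise one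
  joint orbit is lost, but then the transposition also glues two cycles of the product.
\<close>

lemma genus_nonneg:
  assumes "perm_on A a" "perm_on A b"
  shows "ncyc A a + ncyc A b + ncyc A (a \<circ> b) \<le> card A + 2 * njoint A a b"
  using assms
proof (induction "card {x \<in> A. a x \<noteq> x}" arbitrary: a rule: less_induct)
  case (less a)
  have fin: "finite A" using less.prems perm_on_finite by blast
  show ?case
  proof (cases "\<forall>x \<in> A. a x = x")
    case True
    have "ncyc A a \<le> card A" unfolding ncyc_def using fin by (simp add: card_image_le)
    moreover have "ncyc A (a \<circ> b) = ncyc A b"
    proof -
      have "orbit (a \<circ> b) u = orbit b u" if "u \<in> A" for u
        by (rule orbit_cong0[OF that]) (use True perm_on_in[OF less.prems(2)] in auto)
      then show ?thesis unfolding ncyc_def by (metis (mono_tags, lifting) image_cong)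
    qed
    moreover have "njoint A b b \<le> njoint A a b"
    proof (rule joint_classes_refine[OF less.prems less.prems(2,2)])
      fix u assume u: "u \<in> A"
      have "joint a b u \<subseteq> A \<inter> joint b b u"
      proof (rule joint_least)
        show "u \<in> A \<inter> joint b b u" using u joint.base by fast
        fix w assume w: "w \<in> A \<inter> joint b b u"
        then show "a w \<in> A \<inter> joint b b u" using True by simp
        show "b w \<in> A \<inter> joint b b u"
          using w perm_on_in[OF less.prems(2)] joint.left[of w b b u] by blast
      qed
      then show "joint a b u \<subseteq> joint b b u" by blast
    qed
    ultimately show ?thesis using ncyc_eq_njoint[OF less.prems(2)] by linarith
  next
    case False
    then obtain x where x: "x \<in> A" "a x \<noteq> x" by blast
    define y where "y = a x"
    define a' where "a' = transpose x y \<circ> a"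
    have y: "y \<in> A" unfolding y_def using x perm_on_in[OF less.prems(1)] by blast
    have a': "perm_on A a'"
      unfolding a'_def using perm_on_comp[OF perm_on_transpose less.prems(1)] x y fin by blast
    have a'x: "a' x = x" unfolding a'_def y_def by simp
    have a_eq: "a = transpose x y \<circ> a'" unfolding a'_def transpose_involution ..
    have a_eq2: "a z = transpose x y (a' z)" for z unfolding a'_def by simp
    have "a' z = z" if "z \<in> A" "a z = z" for z
    proof -
      have "z \<noteq> y" using that x y inj_onD[OF perm_on_inj[OF less.prems(1)], of y x]
        unfolding y_def by metis
      then show ?thesis unfolding a'_def using that x by (auto simp: transpose_def)
    qed
    then have "{z \<in> A. a' z \<noteq> z} \<subset> {z \<in> A. a z \<noteq> z}" using a'x x by blast
    then have "card {z \<in> A. a' z \<noteq> z} < card {z \<in> A. a z \<noteq> z}"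
      using fin by (intro psubset_card_mono) simp_all
    then have IH: "ncyc A a' + ncyc A b + ncyc A (a' \<circ> b) \<le> card A + 2 * njoint A a' b"
      using less.hyps[OF _ a' less.prems(2)] by blast
    have a1: "ncyc A a + 1 \<le> ncyc A a'"
    proof -
      have "orbit a' x = {x}" using a'x orbit_eq_singleton_iff by metis
      then have "y \<notin> orbit a' x" using x y_def by simp
      then show ?thesis using ncyc_transpose_less[OF a' x(1) y] a_eq by metis
    qed
    have ab: "a \<circ> b = transpose x y \<circ> (a' \<circ> b)" using a_eq2 by (auto simp: fun_eq_iff)
    have a'b: "perm_on A (a' \<circ> b)" and abp: "perm_on A (a \<circ> b)"
      using perm_on_comp a' less.prems by blast+
    show ?thesis
    proof (cases "y \<in> joint a' b x")
      case True
      have "joint a b u \<subseteq> joint a' b u" if "u \<in> A" for u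
        by (rule joint_respects[OF a' less.prems(2) x(1) y True])
          (use that in \<open>simp_all add: a_eq2[symmetric]\<close>)
      then have "njoint A a' b \<le> njoint A a b"
        using joint_classes_refine[OF less.prems a' less.prems(2)] by blast
      moreover have "ncyc A (a \<circ> b) \<le> ncyc A (a' \<circ> b) + 1"
        using ncyc_transpose_le[OF abp x(1) y] unfolding ab transpose_involution .
      ultimately show ?thesis using IH a1 by linarith
    next
      case False
      have "orbit (a' \<circ> b) x \<subseteq> joint a' b x"
        by (rule orbit_subset_joint) (simp add: joint.left joint.right)
      then have "y \<notin> orbit (a' \<circ> b) x" using False by blast
      then have "ncyc A (a \<circ> b) + 1 \<le> ncyc A (a' \<circ> b)"
        using ncyc_transpose_less[OF a'b x(1) y] unfolding ab by blast
      moreover have "njoint A a' b \<le> njoint A a b + 1"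
        by (rule transposed_merge[OF less.prems a' less.prems(2) x(1) y])
          (simp_all add: a_eq2[symmetric])
      ultimately show ?thesis using IH a1 by linarith
    qed
  qed
qed

section \<open>Cycle types and constellations\<close>

lemma orbit_period:
  assumes "perm_on A p" "x \<in> A"
  shows "(p ^^ i) x = x \<longleftrightarrow> card (orbit p x) dvd i"
proof -
  have "\<exists>n. 0 < n \<and> (p ^^ n) x = x"
    using self_in_orbit[OF assms] unfolding orbit_altdef by fastforce
  then have ex: "\<exists>n. (p ^^ n) x = x \<and> 0 < n" by blast
  define n where "n = (LEAST n. (p ^^ n) x = x \<and> 0 < n)"
  have n: "(p ^^ n) x = x" "0 < n" using LeastI_ex[OF ex] unfolding n_def by auto
  have least: "(p ^^ m) x \<noteq> x" if "0 < m" "m < n" for m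
    using not_less_Least[of m "\<lambda>n. (p ^^ n) x = x \<and> 0 < n"] that unfolding n_def by auto
  have "inj_on (\<lambda>k. (p ^^ k) x) {0..<n}"
    by (rule inj_on_funpow_least[OF n(1)]) (use least in auto)
  moreover have "orbit p x = (\<lambda>k. (p ^^ k) x) ` {0..<n}"
    unfolding orbit_altdef_bounded[OF n] by auto
  ultimately have card: "card (orbit p x) = n" by (simp add: card_image)
  have "(p ^^ i) x = (p ^^ (i mod n)) x" using funpow_mod_eq[OF n(1)] by simp
  moreover have "(p ^^ (i mod n)) x = x \<longleftrightarrow> i mod n = 0"
    using least[of "i mod n"] n by (cases "i mod n = 0") auto
  ultimately show ?thesis using card by (simp add: dvd_eq_mod_eq_0)
qed

lemma card_orbit_eqI:
  assumes "perm_on A p" "x \<in> A" "\<And>i. (p ^^ i) x = x \<longleftrightarrow> L dvd i"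
  shows "card (orbit p x) = L"
proof (rule dvd_antisym)
  have "(p ^^ L) x = x" by (simp only: assms(3) dvd_refl)
  then show "card (orbit p x) dvd L" by (simp only: orbit_period[OF assms(1,2)])
  have "(p ^^ card (orbit p x)) x = x" by (simp only: orbit_period[OF assms(1,2)] dvd_refl)
  then show "L dvd card (orbit p x)" by (simp only: assms(3))
qed

text \<open>
  Weighting each point by the reciprocal of its cycle length turns counts of cycles into sums over
  points, which behave well under covers.
\<close>

lemma sum_over_orbits:
  fixes g :: "'a set \<Rightarrow> real"
  assumes "perm_on A p"
  shows "(\<Sum>x\<in>A. g (orbit p x)) = (\<Sum>C\<in>orbit p ` A. real (card C) * g C)"
proof -
  have fib: "{x \<in> A. orbit p x = C} = C" if "C \<in> orbit p ` A" for C
  proof -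
    obtain y where y: "y \<in> A" "C = orbit p y" using \<open>C \<in> _\<close> by blast
    have "orbit p x = C \<longleftrightarrow> x \<in> C" if "x \<in> A" for x
      using orbit_eq[OF assms y(1), of x] self_in_orbit[OF assms that] y(2) by auto
    then show ?thesis using orbit_in[OF assms y(1)] y(2) by auto
  qed
  have "(\<Sum>x\<in>A. g (orbit p x)) = (\<Sum>C\<in>orbit p ` A. \<Sum>x\<in>{x \<in> A. orbit p x = C}. g (orbit p x))"
    by (rule sum.image_gen[OF perm_on_finite[OF assms]])
  also have "\<dots> = (\<Sum>C\<in>orbit p ` A. real (card C) * g C)"
  proof (rule sum.cong[OF refl])
    fix C assume "C \<in> orbit p ` A"
    have "(\<Sum>x\<in>{x \<in> A. orbit p x = C}. g (orbit p x)) = (\<Sum>x\<in>{x \<in> A. orbit p x = C}. g C)"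
      by (rule sum.cong) auto
    then show "(\<Sum>x\<in>{x \<in> A. orbit p x = C}. g (orbit p x)) = real (card C) * g C"
      using fib[OF \<open>C \<in> _\<close>] by simp
  qed
  finally show ?thesis .
qed

definition ctype :: "'a set \<Rightarrow> ('a \<Rightarrow> 'a) \<Rightarrow> nat multiset" where
  "ctype A p = image_mset card (mset_set (orbit p ` A))"

lemma size_ctype: "size (ctype A p) = ncyc A p"
  by (simp add: ctype_def ncyc_def)

lemma set_ctype: "finite A \<Longrightarrow> set_mset (ctype A p) = (\<lambda>x. card (orbit p x)) ` A"
  by (auto simp: ctype_def)

lemma sum_ctype_real:
  fixes g :: "nat \<Rightarrow> real"
  assumes "perm_on A p"
  shows "(\<Sum>k\<in>#ctype A p. g k) = (\<Sum>x\<in>A. g (card (orbit p x)) / real (card (orbit p x)))"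
proof -
  have "(\<Sum>k\<in>#ctype A p. g k) = (\<Sum>C\<in>orbit p ` A. g (card C))"
    by (simp add: ctype_def sum_unfold_sum_mset image_mset.compositionality comp_def)
  also have "\<dots> = (\<Sum>C\<in>orbit p ` A. real (card C) * (g (card C) / real (card C)))"
    by (rule sum.cong) (auto dest: card_orbit_pos[OF assms])
  also have "\<dots> = (\<Sum>x\<in>A. g (card (orbit p x)) / real (card (orbit p x)))"
    by (rule sum_over_orbits[OF assms, symmetric])
  finally show ?thesis .
qed

lemma ncyc_real:
  assumes "perm_on A p"
  shows "real (ncyc A p) = (\<Sum>x\<in>A. 1 / real (card (orbit p x)))"
  using sum_ctype_real[OF assms, of "\<lambda>_. 1"] size_ctype[of A p] by simp

lemma sum_ctype:
  assumes "perm_on A p"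
  shows "sum_mset (ctype A p) = card A"
proof -
  have "real (sum_mset (ctype A p)) = (\<Sum>x\<in>A. 1)"
    unfolding of_nat_sum_mset sum_ctype_real[OF assms]
    by (rule sum.cong) (auto dest: card_orbit_pos[OF assms])
  also have "\<dots> = real (card A)" by simp
  finally show ?thesis by (simp only: of_nat_eq_iff)
qed

text \<open>
  The number of points on cycles of length \<open>L\<close> determines the number of such cycles, so a cycle type
  can be read off from the cycle lengths of the points.
\<close>

lemma count_ctype:
  assumes "perm_on A p"
  shows "count (ctype A p) L * L = card {x \<in> A. card (orbit p x) = L}"
proof -
  have *: "(\<Sum>k\<in>#M. if k = L then real L else 0) = real (count M L * L)" for M
    by (induction M) (auto simp: algebra_simps)
  have "real (count (ctype A p) L * L) = (\<Sum>x\<in>A. if card (orbit p x) = L then 1 else 0)"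
    unfolding *[symmetric] sum_ctype_real[OF assms]
    by (rule sum.cong) (auto dest: card_orbit_pos[OF assms])
  also have "\<dots> = real (card {x \<in> A. card (orbit p x) = L})"
    using perm_on_finite[OF assms] by (simp add: sum.If_cases Int_def)
  finally show ?thesis by linarith
qed

text \<open>
  For a transitive pair of permutations, with \<open>a \<circ> b\<close> as the third one; in the usual
  symmetric normalisation the third permutation is \<open>(a \<circ> b)\<^sup>-\<^sup>1\<close>, which has the same cycles.
\<close>

definition constellation :: "'a set \<Rightarrow> ('a \<Rightarrow> 'a) \<Rightarrow> ('a \<Rightarrow> 'a) \<Rightarrow> bool" where
  "constellation A a b \<longleftrightarrow>
     perm_on A a \<and> perm_on A b \<and> A \<noteq> {} \<and> (\<forall>x \<in> A. joint a b x = A)"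

lemma constellationD:
  assumes "constellation A a b"
  shows "perm_on A a" "perm_on A b" "perm_on A (a \<circ> b)" "finite A" "A \<noteq> {}"
    "x \<in> A \<Longrightarrow> a x \<in> A" "x \<in> A \<Longrightarrow> b x \<in> A"
proof -
  show "perm_on A a" "perm_on A b" "A \<noteq> {}" using assms unfolding constellation_def by auto
  then show "perm_on A (a \<circ> b)" "finite A" "x \<in> A \<Longrightarrow> a x \<in> A" "x \<in> A \<Longrightarrow> b x \<in> A"
    by (simp_all add: perm_on_comp perm_on_finite perm_on_in)
qed

lemma constellationI:
  assumes "perm_on A a" "perm_on A b" "x \<in> A" "A \<subseteq> joint a b x"
  shows "constellation A a b"
  unfolding constellation_def
  using assms joint_subset[OF assms(1,2)] joint_eq[OF assms(1-3)] by blast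

lemma constellation_induct [consumes 3, case_names base left right]:
  assumes "constellation A a b" "x \<in> A" "z \<in> A" and "P x"
    and "\<And>y. y \<in> A \<Longrightarrow> P y \<Longrightarrow> P (a y)" "\<And>y. y \<in> A \<Longrightarrow> P y \<Longrightarrow> P (b y)"
  shows "P z"
proof -
  have "joint a b x \<subseteq> {y \<in> A. P y}"
    by (rule joint_least) (use assms constellationD(6,7)[OF assms(1)] in auto)
  then show ?thesis using assms unfolding constellation_def by blast
qed

lemma constellation_genus:
  assumes "constellation A a b"
  shows "ncyc A a + ncyc A b + ncyc A (a \<circ> b) \<le> card A + 2"
proof -
  have "joint a b ` A = {A}" using assms unfolding constellation_def by auto
  then show ?thesis using genus_nonneg[of A a b] constellationD(1,2)[OF assms]
    by (simp add: njoint_def)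
qed

section \<open>Equivariant maps and the lifting of planar constellations\<close>

text \<open>
  The generators map fibres injectively into fibres, so by transitivity no fibre is larger than
  another.
\<close>

lemma equivariant_fibres:
  assumes A: "constellation A a b" and B: "constellation B c d"
    and f: "\<And>x. x \<in> A \<Longrightarrow> f x \<in> B" "\<And>x. x \<in> A \<Longrightarrow> f (a x) = c (f x)"
      "\<And>x. x \<in> A \<Longrightarrow> f (b x) = d (f x)"
  obtains N where "N > 0" "\<And>y. y \<in> B \<Longrightarrow> card {x \<in> A. f x = y} = N"
proof -
  note AD = constellationD[OF A] and BD = constellationD[OF B]
  define F where "F y = card {x \<in> A. f x = y}" for y
  have step: "F y \<le> F (q y)"
    if p: "perm_on A p" "\<And>x. x \<in> A \<Longrightarrow> f (p x) = q (f x)" for p q y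
    unfolding F_def
  proof (rule card_inj_on_le[of p])
    show "inj_on p {x \<in> A. f x = y}" using perm_on_inj[OF p(1)] by (auto simp: inj_on_def)
    show "p ` {x \<in> A. f x = y} \<subseteq> {x \<in> A. f x = q y}" using p perm_on_in[OF p(1)] by auto
  qed (use AD in simp)
  have le: "F y \<le> F z" if "y \<in> B" "z \<in> B" for y z
    using B that
  proof (induction rule: constellation_induct)
    case (left z)
    then show ?case using step[OF AD(1) f(2)] le_trans by blast
  next
    case (right z)
    then show ?case using step[OF AD(2) f(3)] le_trans by blast
  qed simp
  obtain x where x: "x \<in> A" using AD(5) by blast
  have "F (f x) > 0" unfolding F_def using x AD(4) by (auto simp: card_gt_0_iff)
  moreover have "F y = F (f x)" if "y \<in> B" for y using le f(1)[OF x] that by (simp add: antisym)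
  ultimately show thesis using that unfolding F_def by blast
qed

lemma sum_fibres:
  fixes g :: "'b \<Rightarrow> real"
  assumes "finite A" "finite B" "\<And>x. x \<in> A \<Longrightarrow> f x \<in> B"
    and "\<And>y. y \<in> B \<Longrightarrow> card {x \<in> A. f x = y} = N"
  shows "(\<Sum>x\<in>A. g (f x)) = real N * (\<Sum>y\<in>B. g y)"
proof -
  have "(\<Sum>x\<in>A. g (f x)) = (\<Sum>y\<in>B. \<Sum>x\<in>{x \<in> A. f x = y}. g (f x))"
    by (rule sum.group[symmetric]) (use assms in auto)
  also have "\<dots> = (\<Sum>y\<in>B. real N * g y)"
  proof (rule sum.cong[OF refl])
    fix y assume "y \<in> B"
    have "(\<Sum>x\<in>{x \<in> A. f x = y}. g (f x)) = (\<Sum>x\<in>{x \<in> A. f x = y}. g y)"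
      by (rule sum.cong) auto
    then show "(\<Sum>x\<in>{x \<in> A. f x = y}. g (f x)) = real N * g y"
      using assms(4)[OF \<open>y \<in> B\<close>] by simp
  qed
  finally show ?thesis by (simp add: sum_distrib_left)
qed

lemma perm_on_map_prod: "perm_on A p \<Longrightarrow> perm_on B q \<Longrightarrow> perm_on (A \<times> B) (map_prod p q)"
  unfolding perm_on_def by (simp add: bij_betw_map_prod)

lemma funpow_map_prod:
  fixes p :: "'a \<Rightarrow> 'a" and q :: "'b \<Rightarrow> 'b"
  shows "(map_prod p q ^^ i) (x, y) = ((p ^^ i) x, (q ^^ i) y)"
  by (induction i) auto

text \<open>
  The length of a product cycle is the least common multiple of the two lengths; under
  divisibility it is the first one.  This is what makes the cover \<open>C\<close> below unramified.
\<close>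

lemma card_orbit_map_prod:
  assumes "perm_on A p" "x \<in> A" "perm_on B q" "y \<in> B"
    and "card (orbit q y) dvd card (orbit p x)"
  shows "card (orbit (map_prod p q) (x, y)) = card (orbit p x)"
proof (rule card_orbit_eqI)
  show "(map_prod p q ^^ i) (x, y) = (x, y) \<longleftrightarrow> card (orbit p x) dvd i" for i
    unfolding funpow_map_prod
    using orbit_period[OF assms(1,2)] orbit_period[OF assms(3,4)] assms(5) by (auto intro: dvd_trans)
qed (use assms perm_on_map_prod in auto)

text \<open>
  Simple connectedness of the sphere in combinatorial form.  A joint orbit \<open>C\<close> in \<open>E \<times> F\<close> covers \<open>E\<close>
  with some degree \<open>N\<close>, and each cycle of \<open>E\<close> lifts to exactly \<open>N\<close> cycles of the same length.  So
  \<open>C\<close> has \<open>N (card E + 2)\<close> cycles and \<open>N card E\<close> points, and the genus inequality leaves only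
  \<open>N = 1\<close>.
\<close>

theorem planar_lifting:
  assumes E: "constellation E a b"
    and planar: "ncyc E a + ncyc E b + ncyc E (a \<circ> b) = card E + 2"
    and F: "constellation F c d"
    and dvd: "\<And>x y. x \<in> E \<Longrightarrow> y \<in> F \<Longrightarrow> card (orbit c y) dvd card (orbit a x)"
      "\<And>x y. x \<in> E \<Longrightarrow> y \<in> F \<Longrightarrow> card (orbit d y) dvd card (orbit b x)"
      "\<And>x y. x \<in> E \<Longrightarrow> y \<in> F \<Longrightarrow> card (orbit (c \<circ> d) y) dvd card (orbit (a \<circ> b) x)"
  obtains h where "\<And>x. x \<in> E \<Longrightarrow> h x \<in> F" "\<And>x. x \<in> E \<Longrightarrow> h (a x) = c (h x)"
    "\<And>x. x \<in> E \<Longrightarrow> h (b x) = d (h x)"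
proof -
  note ED = constellationD[OF E] and FD = constellationD[OF F]
  obtain e0 f0 where ef: "e0 \<in> E" "f0 \<in> F" using ED(5) FD(5) by blast
  define A where "A = map_prod a c"
  define B where "B = map_prod b d"
  define C where "C = joint A B (e0, f0)"
  have P: "perm_on (E \<times> F) A" "perm_on (E \<times> F) B"
    unfolding A_def B_def using perm_on_map_prod ED FD by blast+
  have sub: "C \<subseteq> E \<times> F" unfolding C_def using joint_subset[OF P] ef by blast
  have inC: "A z \<in> C" "B z \<in> C" if "z \<in> C" for z
    using that unfolding C_def by (auto intro: joint.left joint.right)
  have C: "constellation C A B"
  proof (rule constellationI)
    show "perm_on C A" "perm_on C B" using perm_on_invariant[OF _ sub] P inC by blast+
    show "(e0, f0) \<in> C" "C \<subseteq> joint A B (e0, f0)" unfolding C_def by (auto intro: joint.base)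
  qed
  have fstE: "fst z \<in> E" "snd z \<in> F" if "z \<in> C" for z using that sub by auto
  obtain N where N: "N > 0" "\<And>y. y \<in> E \<Longrightarrow> card {z \<in> C. fst z = y} = N"
    by (rule equivariant_fibres[OF C E, of fst]) (auto simp: A_def B_def fstE)
  have finC: "finite C" using constellationD[OF C] by blast
  have cyc: "real (ncyc C (map_prod p q)) = real N * real (ncyc E p)"
    if "perm_on E p" "perm_on F q" "perm_on C (map_prod p q)"
      "\<And>x y. x \<in> E \<Longrightarrow> y \<in> F \<Longrightarrow> card (orbit q y) dvd card (orbit p x)" for p q
  proof -
    have "real (ncyc C (map_prod p q)) = (\<Sum>z\<in>C. 1 / real (card (orbit p (fst z))))"
      unfolding ncyc_real[OF that(3)]
    proof (rule sum.cong[OF refl])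
      fix z assume z: "z \<in> C"
      obtain x y where "z = (x, y)" by force
      then show "1 / real (card (orbit (map_prod p q) z)) = 1 / real (card (orbit p (fst z)))"
        using card_orbit_map_prod[OF that(1) _ that(2)] that(4) fstE[OF z] by simp
    qed
    also have "\<dots> = real N * (\<Sum>x\<in>E. 1 / real (card (orbit p x)))"
      by (rule sum_fibres[OF finC ED(4)]) (use fstE N in auto)
    finally show ?thesis unfolding ncyc_real[OF that(1)] .
  qed
  have AB: "A \<circ> B = map_prod (a \<circ> b) (c \<circ> d)" unfolding A_def B_def by (auto simp: fun_eq_iff)
  have CP: "perm_on C (map_prod a c)" "perm_on C (map_prod b d)"
    "perm_on C (map_prod (a \<circ> b) (c \<circ> d))"
    using constellationD(1-3)[OF C] unfolding AB by (simp_all add: A_def B_def)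
  have "real (ncyc C A) = real N * real (ncyc E a)"
    unfolding A_def by (rule cyc[OF ED(1) FD(1) CP(1) dvd(1)])
  moreover have "real (ncyc C B) = real N * real (ncyc E b)"
    unfolding B_def by (rule cyc[OF ED(2) FD(2) CP(2) dvd(2)])
  moreover have "real (ncyc C (A \<circ> B)) = real N * real (ncyc E (a \<circ> b))"
    unfolding AB by (rule cyc[OF ED(3) FD(3) CP(3) dvd(3)])
  moreover have "real (card C) = real N * real (card E)"
    using sum_fibres[OF finC ED(4), of fst N "\<lambda>_. 1"] fstE N by simp
  moreover have "real (ncyc C A) + real (ncyc C B) + real (ncyc C (A \<circ> B)) \<le> real (card C) + 2"
    using constellation_genus[OF C] by linarith
  moreover have "real N * (real (ncyc E a) + real (ncyc E b) + real (ncyc E (a \<circ> b)))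
      = real N * (real (card E) + 2)"
    using arg_cong[OF planar, of real] by simp
  ultimately have "real N * 2 \<le> 2" by (simp add: algebra_simps)
  then have N1: "N = 1" using N(1) by linarith
  define h where "h x = (THE y. (x, y) \<in> C)" for x
  have uniq: "\<exists>!y. (x, y) \<in> C" if x: "x \<in> E" for x
  proof -
    obtain z where z: "{z \<in> C. fst z = x} = {z}"
      using N(2)[OF x] N1 by (metis card_1_singletonE)
    have zC: "w \<in> C \<and> fst w = x \<longleftrightarrow> w = z" for w using z by (metis (mono_tags, lifting) mem_Collect_eq singleton_iff)
    show ?thesis
    proof (rule ex1I[of _ "snd z"])
      show "(x, snd z) \<in> C" using zC[of z] by (metis prod.collapse)
      show "y = snd z" if "(x, y) \<in> C" for y using zC[of "(x, y)"] that by auto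
    qed
  qed
  have hC: "(x, h x) \<in> C" if "x \<in> E" for x
    unfolding h_def by (rule theI'[OF uniq[OF that]])
  have hI: "h x = y" if "x \<in> E" "(x, y) \<in> C" for x y
    using uniq[OF that(1)] hC[OF that(1)] that(2) by blast
  show thesis
  proof (rule that)
    fix x assume x: "x \<in> E"
    show "h x \<in> F" using hC[OF x] sub by blast
    show "h (a x) = c (h x)"
      using hI[OF ED(6)[OF x], of "c (h x)"] inC(1)[OF hC[OF x]] unfolding A_def by simp
    show "h (b x) = d (h x)"
      using hI[OF ED(7)[OF x], of "d (h x)"] inC(2)[OF hC[OF x]] unfolding B_def by simp
  qed
qed

lemma card_orbit_le_fibre:
  assumes p: "perm_on A p" and q: "perm_on B q" and x: "x \<in> A"
    and h: "\<And>x. x \<in> A \<Longrightarrow> h x \<in> B" "\<And>x. x \<in> A \<Longrightarrow> h (p x) = q (h x)"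
    and N: "\<And>y. y \<in> B \<Longrightarrow> card {x \<in> A. h x = y} = N"
  shows "card (orbit p x) \<le> N * card (orbit q (h x))"
proof -
  let ?O = "orbit q (h x)"
  have O: "?O \<subseteq> B" using orbit_in[OF q h(1)[OF x]] .
  have "orbit p x \<subseteq> (\<Union>y\<in>?O. {z \<in> A. h z = y})"
  proof
    fix z assume "z \<in> orbit p x"
    then have "z \<in> A \<and> h z \<in> ?O"
      by induct (auto simp: x h perm_on_in[OF p] intro: orbit.intros)
    then show "z \<in> (\<Union>y\<in>?O. {z \<in> A. h z = y})" by blast
  qed
  then have "card (orbit p x) \<le> card (\<Union>y\<in>?O. {z \<in> A. h z = y})"
    by (rule card_mono[rotated]) (use finite_orbit_on[OF q h(1)[OF x]] perm_on_finite[OF p] in auto)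
  also have "\<dots> \<le> (\<Sum>y\<in>?O. card {z \<in> A. h z = y})"
    by (rule card_UN_le) (use finite_orbit_on[OF q h(1)[OF x]] in auto)
  also have "\<dots> = (\<Sum>y\<in>?O. N)" by (rule sum.cong) (use O N in auto)
  finally show ?thesis by (simp add: mult.commute)
qed

text \<open>
  The regular case: all cycles of \<open>F\<close> have prescribed lengths.  The number \<open>N\<close> is the degree of the
  lifted map, and a cycle can wind at most \<open>N\<close> times around the cycle below it.
\<close>

theorem planar_lifting_degree:
  assumes E: "constellation E a b"
    and planar: "ncyc E a + ncyc E b + ncyc E (a \<circ> b) = card E + 2"
    and F: "constellation F c d"
    and len: "\<And>y. y \<in> F \<Longrightarrow> card (orbit c y) = k" "\<And>y. y \<in> F \<Longrightarrow> card (orbit d y) = m"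
      "\<And>y. y \<in> F \<Longrightarrow> card (orbit (c \<circ> d) y) = l"
    and dvd: "\<And>x. x \<in> E \<Longrightarrow> k dvd card (orbit a x)" "\<And>x. x \<in> E \<Longrightarrow> m dvd card (orbit b x)"
      "\<And>x. x \<in> E \<Longrightarrow> l dvd card (orbit (a \<circ> b) x)"
  obtains N where "card E = N * card F" "\<And>x. x \<in> E \<Longrightarrow> card (orbit a x) \<le> N * k"
    "\<And>x. x \<in> E \<Longrightarrow> card (orbit b x) \<le> N * m" "\<And>x. x \<in> E \<Longrightarrow> card (orbit (a \<circ> b) x) \<le> N * l"
proof -
  note ED = constellationD[OF E] and FD = constellationD[OF F]
  obtain h where h: "\<And>x. x \<in> E \<Longrightarrow> h x \<in> F" "\<And>x. x \<in> E \<Longrightarrow> h (a x) = c (h x)"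
    "\<And>x. x \<in> E \<Longrightarrow> h (b x) = d (h x)"
  proof (rule planar_lifting[OF E planar F])
    fix x y assume "x \<in> E" "y \<in> F"
    then show "card (orbit c y) dvd card (orbit a x)" "card (orbit d y) dvd card (orbit b x)"
      "card (orbit (c \<circ> d) y) dvd card (orbit (a \<circ> b) x)" using len dvd by simp_all
  qed (rule that)
  obtain N where N: "\<And>y. y \<in> F \<Longrightarrow> card {x \<in> E. h x = y} = N"
    using equivariant_fibres[OF E F h] by metis
  have hab: "h ((a \<circ> b) x) = (c \<circ> d) (h x)" if "x \<in> E" for x
    using that h ED(7) by simp
  show thesis
  proof (rule that)
    have "real (card E) = real N * real (card F)"
      using sum_fibres[OF ED(4) FD(4) h(1) N, of "\<lambda>_. 1"] by simp
    then show "card E = N * card F" by (metis of_nat_eq_iff of_nat_mult)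
  next
    fix x assume x: "x \<in> E"
    show "card (orbit a x) \<le> N * k"
      using card_orbit_le_fibre[OF ED(1) FD(1) x h(1,2) N] len h(1)[OF x] by simp
    show "card (orbit b x) \<le> N * m"
      using card_orbit_le_fibre[OF ED(2) FD(2) x h(1,3) N] len h(1)[OF x] by simp
    show "card (orbit (a \<circ> b) x) \<le> N * l"
      using card_orbit_le_fibre[OF ED(3) FD(3) x h(1) hab N] unfolding len(3)[OF h(1)[OF x]] .
  qed
qed

section \<open>Permuting the three partitions\<close>

lemma ctype_conj:
  assumes p: "perm_on A p" and f: "inj_on f A" "\<And>x. x \<in> A \<Longrightarrow> q (f x) = f (p x)"
  shows "ctype (f ` A) q = ctype A p"
proof -
  have orb: "orbit q (f x) = f ` orbit p x" if "x \<in> A" for x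
    by (rule orbit_inverse[symmetric, OF self_in_orbit[OF p that]])
      (use orbit_in[OF p that] f(2) in blast)
  have sub: "C \<subseteq> A" if "C \<in> orbit p ` A" for C using that orbit_in[OF p] by blast
  have inj: "inj_on ((`) f) (orbit p ` A)"
    by (rule inj_onI) (metis inj_on_image_eq_iff[OF f(1)] sub)
  have "orbit q ` f ` A = (`) f ` (orbit p ` A)"
    unfolding image_image by (rule image_cong) (simp_all add: orb)
  then have "ctype (f ` A) q = image_mset card (image_mset ((`) f) (mset_set (orbit p ` A)))"
    unfolding ctype_def by (simp add: image_mset_mset_set[OF inj])
  also have "\<dots> = image_mset card (mset_set (orbit p ` A))"
    unfolding image_mset.compositionality
  proof (rule image_mset_cong)
    fix C assume "C \<in># mset_set (orbit p ` A)"
    then have "C \<in> orbit p ` A" using perm_on_finite[OF p] by simp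
    then show "(card \<circ> (`) f) C = card C"
      using sub inj_on_subset[OF f(1)] by (simp add: card_image)
  qed
  finally show ?thesis unfolding ctype_def .
qed

lemma ctype_cong:
  assumes "perm_on A p" "\<And>x. x \<in> A \<Longrightarrow> q x = p x"
  shows "ctype A q = ctype A p"
  using ctype_conj[OF assms(1), of "\<lambda>x. x" q] assms(2) by simp

text \<open>
  Fixing the carrier type to \<open>nat\<close> loses nothing, by \<open>constellation_realized\<close>, and gives a predicate
  on partitions alone, on which the symmetric group acts.
\<close>

definition realized :: "nat multiset \<Rightarrow> nat multiset \<Rightarrow> nat multiset \<Rightarrow> bool" where
  "realized P1 P2 P3 \<longleftrightarrow> (\<exists>(A :: nat set) a b. constellation A a b \<and>
     ctype A a = P1 \<and> ctype A b = P2 \<and> ctype A (a \<circ> b) = P3)"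

lemma constellation_realized:
  assumes A: "constellation A a b"
  shows "realized (ctype A a) (ctype A b) (ctype A (a \<circ> b))"
proof -
  note AD = constellationD[OF A]
  obtain f :: "'a \<Rightarrow> nat" where f: "inj_on f A"
    using finite_imp_inj_to_nat_seg[OF AD(4)] by blast
  define g where "g = inv_into A f"
  have gf: "g (f x) = x" if "x \<in> A" for x unfolding g_def using f that by simp
  have perm: "perm_on (f ` A) (f \<circ> p \<circ> g)" if "perm_on A p" for p
  proof (rule perm_onI)
    show "inj_on (f \<circ> p \<circ> g) (f ` A)"
    proof (rule inj_onI, elim imageE)
      fix u v x y assume "(f \<circ> p \<circ> g) u = (f \<circ> p \<circ> g) v" "u = f x" "x \<in> A" "v = f y" "y \<in> A"
      then have "f (p x) = f (p y)" by (simp add: gf)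
      then have "p x = p y"
        using inj_onD[OF f] perm_on_in[OF that] \<open>x \<in> A\<close> \<open>y \<in> A\<close> by blast
      then show "u = v"
        using inj_onD[OF perm_on_inj[OF that]] \<open>x \<in> A\<close> \<open>y \<in> A\<close> \<open>u = f x\<close> \<open>v = f y\<close> by blast
    qed
  qed (use perm_on_in[OF that] AD(4) gf in auto)
  obtain x where x: "x \<in> A" using AD(5) by blast
  have B: "constellation (f ` A) (f \<circ> a \<circ> g) (f \<circ> b \<circ> g)"
  proof (rule constellationI[of _ _ _ "f x"])
    have "f z \<in> joint (f \<circ> a \<circ> g) (f \<circ> b \<circ> g) (f x)" if "z \<in> A" for z
      using A x that
    proof (induction rule: constellation_induct)
      case (left y)
      then show ?case using joint.left[OF left(2)] gf[OF left(1)] by simp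
    next
      case (right y)
      then show ?case using joint.right[OF right(2)] gf[OF right(1)] by simp
    qed (rule joint.base)
    then show "f ` A \<subseteq> joint (f \<circ> a \<circ> g) (f \<circ> b \<circ> g) (f x)" by blast
  qed (use x perm AD in auto)
  have "ctype (f ` A) (f \<circ> p \<circ> g) = ctype A p" if "perm_on A p" for p
    by (rule ctype_conj[OF that f]) (simp add: gf)
  moreover have "ctype (f ` A) ((f \<circ> a \<circ> g) \<circ> (f \<circ> b \<circ> g)) = ctype A (a \<circ> b)"
    by (rule ctype_conj[OF AD(3) f]) (simp add: gf AD(7))
  ultimately show ?thesis unfolding realized_def using B AD(1,2) by metis
qed

text \<open>
  The pair \<open>(b, a)\<close> does it, since \<open>b\<close> conjugates \<open>a \<circ> b\<close> to \<open>b \<circ> a\<close>.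
\<close>

lemma realized_swap12:
  assumes "realized P1 P2 P3"
  shows "realized P2 P1 P3"
proof -
  obtain A :: "nat set" and a b where A: "constellation A a b"
    and P: "ctype A a = P1" "ctype A b = P2" "ctype A (a \<circ> b) = P3"
    using assms unfolding realized_def by blast
  note AD = constellationD[OF A]
  obtain x where x: "x \<in> A" using AD(5) by blast
  have "constellation A b a"
  proof (rule constellationI[OF AD(2,1) x])
    show "A \<subseteq> joint b a x"
    proof
      fix z assume "z \<in> A"
      with A x show "z \<in> joint b a x"
        by (induction rule: constellation_induct) (simp_all add: joint.base joint.left joint.right)
    qed
  qed
  moreover have "ctype A (b \<circ> a) = ctype A (a \<circ> b)"
  proof -
    have "b ` A = A" using AD(2) unfolding perm_on_def bij_betw_def by blast
    then show ?thesis
      using ctype_conj[OF AD(3) perm_on_inj[OF AD(2)], of "b \<circ> a"] by simp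
  qed
  ultimately show ?thesis unfolding realized_def using P by metis
qed

lemma inverse_perm:
  assumes "perm_on A p"
  obtains q where "perm_on A q" "\<And>x. x \<in> A \<Longrightarrow> p (q x) = x" "\<And>x. x \<in> A \<Longrightarrow> q (p x) = x"
proof
  show "perm_on A (inv_into A p)" using assms bij_betw_inv_into unfolding perm_on_def by blast
  show "p (inv_into A p x) = x" if "x \<in> A" for x
    using assms that unfolding perm_on_def by (metis bij_betw_inv_into_right)
  show "inv_into A p (p x) = x" if "x \<in> A" for x
    using perm_on_inj[OF assms] that by simp
qed

lemma orbit_inverse_subset:
  assumes p: "perm_on A p" and q: "perm_on A q" and pq: "\<And>x. x \<in> A \<Longrightarrow> p (q x) = x" and x: "x \<in> A"
  shows "orbit q x \<subseteq> orbit p x"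
proof
  fix y assume "y \<in> orbit q x"
  then show "y \<in> orbit p x"
  proof induct
    case base
    have "p (q x) \<in> orbit p x" using pq[OF x] self_in_orbit[OF p x] by simp
    then show ?case
      using perm_on_invariant_iff[OF p orbit_in[OF p x], of "q x"] orbit.step perm_on_in[OF q x] by fast
  next
    case (step y)
    then have y: "y \<in> A" using orbit_in[OF p x] by blast
    have "p (q y) \<in> orbit p x" using pq[OF y] step by simp
    then show ?case
      using perm_on_invariant_iff[OF p orbit_in[OF p x], of "q y"] orbit.step perm_on_in[OF q y] by fast
  qed
qed

text \<open>
  The pair \<open>(a\<^sup>-\<^sup>1, a \<circ> b)\<close> does it: its product is \<open>b\<close>.
\<close>

lemma realized_swap23:
  assumes "realized P1 P2 P3"
  shows "realized P1 P3 P2"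
proof -
  obtain A :: "nat set" and a b where A: "constellation A a b"
    and P: "ctype A a = P1" "ctype A b = P2" "ctype A (a \<circ> b) = P3"
    using assms unfolding realized_def by blast
  note AD = constellationD[OF A]
  obtain x where x: "x \<in> A" using AD(5) by blast
  obtain a' where a': "perm_on A a'" "\<And>x. x \<in> A \<Longrightarrow> a (a' x) = x" "\<And>x. x \<in> A \<Longrightarrow> a' (a x) = x"
    using inverse_perm[OF AD(1)] by metis
  let ?J = "joint a' (a \<circ> b) x"
  have J: "?J \<subseteq> A" using joint_subset[OF a'(1) AD(3) x] .
  have "constellation A a' (a \<circ> b)"
  proof (rule constellationI[OF a'(1) AD(3) x])
    have "joint a b x \<subseteq> ?J"
    proof (rule joint_least)
      fix y assume y: "y \<in> ?J"
      have "a' (a y) \<in> ?J" using y J a'(3) by auto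
      then show "a y \<in> ?J"
        using perm_on_invariant_iff[OF a'(1) J joint.left, of "a y"] J y AD(6) by blast
      have "a' ((a \<circ> b) y) \<in> ?J" using y by (blast intro: joint.left joint.right)
      then show "b y \<in> ?J" using a'(3)[OF AD(7)] J y by auto
    qed (rule joint.base)
    then show "A \<subseteq> ?J" using A x unfolding constellation_def by blast
  qed
  moreover have "ctype A a' = ctype A a"
  proof -
    have "orbit a' y = orbit a y" if "y \<in> A" for y
      using orbit_inverse_subset[OF AD(1) a'(1,2) that] orbit_inverse_subset[OF a'(1) AD(1) a'(3) that]
      by blast
    then show ?thesis unfolding ctype_def by (simp cong: image_cong_simp)
  qed
  moreover have "ctype A (a' \<circ> (a \<circ> b)) = ctype A b"
    by (rule ctype_cong[OF AD(2)]) (simp add: a'(3) AD(7))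
  ultimately show ?thesis unfolding realized_def using P by metis
qed

section \<open>Skew products with a cyclic group\<close>

text \<open>
  The cover of degree \<open>s\<close> with sheets \<open>{0..<s}\<close> that moves \<open>c x\<close> sheets up while \<open>p\<close> moves on from \<open>x\<close>.
\<close>

definition skew :: "nat \<Rightarrow> ('a \<Rightarrow> 'a) \<Rightarrow> ('a \<Rightarrow> int) \<Rightarrow> 'a \<times> int \<Rightarrow> 'a \<times> int" where
  "skew s p c = (\<lambda>(x, u). (p x, (u + c x) mod int s))"

text \<open>
  The total shift of sheets along one turn around the cycle of \<open>x\<close>: the cycle lifts to closed
  cycles of the same length iff it vanishes modulo the degree.
\<close>

definition flux :: "('a \<Rightarrow> 'a) \<Rightarrow> ('a \<Rightarrow> int) \<Rightarrow> 'a \<Rightarrow> int" where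
  "flux p c x = (\<Sum>y\<in>orbit p x. c y)"

lemma skew_comp:
  "skew s p c \<circ> skew s q d = skew s (p \<circ> q) (\<lambda>x. d x + c (q x))"
  by (auto simp: skew_def fun_eq_iff mod_simps algebra_simps)

lemma perm_on_skew:
  assumes "perm_on A p" "s > 0"
  shows "perm_on (A \<times> {0..<int s}) (skew s p c)"
proof (rule perm_onI)
  show "inj_on (skew s p c) (A \<times> {0..<int s})"
  proof (rule inj_onI, clarify)
    fix x y u v assume xy: "x \<in> A" "y \<in> A" "u \<in> {0..<int s}" "v \<in> {0..<int s}"
      and eq: "skew s p c (x, u) = skew s p c (y, v)"
    then have "x = y" using inj_onD[OF perm_on_inj[OF assms(1)]] by (auto simp: skew_def)
    then have "(u + c x) mod int s = (v + c x) mod int s" using eq by (simp add: skew_def)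
    then have "int s dvd u - v" by (simp add: mod_eq_dvd_iff)
    then have "u mod int s = v mod int s" by (simp add: mod_eq_dvd_iff)
    then show "x = y \<and> u = v" using xy \<open>x = y\<close> by simp
  qed
qed (use assms perm_on_in[OF assms(1)] perm_on_finite[OF assms(1)] in \<open>auto simp: skew_def\<close>)

lemma funpow_skew:
  assumes "u \<in> {0..<int s}"
  shows "(skew s p c ^^ i) (x, u) = ((p ^^ i) x, (u + (\<Sum>j<i. c ((p ^^ j) x))) mod int s)"
  using assms by (induction i) (auto simp: skew_def mod_simps algebra_simps)

lemma sum_along_orbit:
  assumes p: "perm_on A p" and x: "x \<in> A"
  shows "(\<Sum>j<card (orbit p x) * q. c ((p ^^ j) x)) = int q * flux p c x"
proof (induction q)
  case (Suc q)
  let ?L = "card (orbit p x)"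
  have per: "(p ^^ (?L * q)) x = x" using orbit_period[OF p x, of "?L * q"] by simp
  have perL: "(p ^^ ?L) x = x" using orbit_period[OF p x, of ?L] by simp
  have img: "orbit p x = (\<lambda>j. (p ^^ j) x) ` {..<?L}"
    using orbit_altdef_bounded[OF perL card_orbit_pos[OF p x]] by auto
  then have inj: "inj_on (\<lambda>j. (p ^^ j) x) {..<?L}"
    by (intro eq_card_imp_inj_on) (simp_all add: img[symmetric])
  have one: "(\<Sum>j<?L. c ((p ^^ j) x)) = flux p c x"
    unfolding flux_def by (subst (2) img) (simp add: sum.reindex[OF inj] comp_def)
  have "(\<Sum>j<?L * Suc q. c ((p ^^ j) x))
      = (\<Sum>j<?L * q. c ((p ^^ j) x)) + (\<Sum>j<?L. c ((p ^^ (j + ?L * q)) x))"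
    using sum.nat_group[of "\<lambda>j. c ((p ^^ j) x)" "?L * q"]
      sum.atLeastLessThan_concat[of 0 "?L * q" "?L * Suc q" "\<lambda>j. c ((p ^^ j) x)"]
      sum.shift_bounds_nat_ivl[of "\<lambda>j. c ((p ^^ j) x)" 0 "?L * q" ?L]
    by (simp add: lessThan_atLeast0 add.commute)
  also have "(\<Sum>j<?L. c ((p ^^ (j + ?L * q)) x)) = (\<Sum>j<?L. c ((p ^^ j) x))"
    by (rule sum.cong) (simp_all add: funpow_add per)
  finally show ?case using Suc one by (simp add: algebra_simps)
qed simp

lemma card_orbit_skew:
  assumes p: "perm_on A p" and x: "x \<in> A" and u: "u \<in> {0..<int s}"
    and fl: "flux p c x \<in> {-1, 0, 1}"
  shows "card (orbit (skew s p c) (x, u)) = card (orbit p x) * (if flux p c x = 0 then 1 else s)"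
proof (rule card_orbit_eqI)
  let ?L = "card (orbit p x)"
  have s: "s > 0" using u by (cases s) auto
  show "perm_on (A \<times> {0..<int s}) (skew s p c)" using perm_on_skew[OF p s] .
  show "(x, u) \<in> A \<times> {0..<int s}" using x u by simp
  fix i
  show "(skew s p c ^^ i) (x, u) = (x, u) \<longleftrightarrow> ?L * (if flux p c x = 0 then 1 else s) dvd i"
  proof (cases "?L dvd i")
    case False
    then have "(skew s p c ^^ i) (x, u) \<noteq> (x, u)"
      unfolding funpow_skew[OF u] using orbit_period[OF p x, of i] by simp
    moreover have "\<not> ?L * r dvd i" for r using False dvd_mult_left by blast
    ultimately show ?thesis by blast
  next
    case True
    then obtain q where q: "i = ?L * q" by blast
    have "(u + int q * flux p c x) mod int s = u \<longleftrightarrow> int s dvd int q * flux p c x"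
    proof -
      have "(u + int q * flux p c x) mod int s = u \<longleftrightarrow>
          (u + int q * flux p c x) mod int s = u mod int s" using u by simp
      also have "\<dots> \<longleftrightarrow> int s dvd int q * flux p c x" by (simp add: mod_eq_dvd_iff)
      finally show ?thesis .
    qed
    also have "\<dots> \<longleftrightarrow> (if flux p c x = 0 then 1 else s) dvd q"
      using fl by auto
    also have "\<dots> \<longleftrightarrow> ?L * (if flux p c x = 0 then 1 else s) dvd i"
      unfolding q using card_orbit_pos[OF p x] by (simp add: dvd_mult_cancel1)
    finally show ?thesis
      using orbit_period[OF p x, of i] True
      unfolding funpow_skew[OF u] q sum_along_orbit[OF p x] by simp
  qed
qed

text \<open>
  Around a totally ramified cycle all sheets are connected.
\<close>

lemma skew_fibre_reachable:
  assumes p: "perm_on A p" and x: "x \<in> A" and fl: "flux p c x \<in> {-1, 1}" and v: "v \<in> {0..<int s}"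
  shows "\<exists>i. (skew s p c ^^ i) (x, 0) = (x, v)"
proof -
  define q where "q = nat ((flux p c x * v) mod int s)"
  have s: "0 < int s" using v by simp
  have q: "int q = (flux p c x * v) mod int s" unfolding q_def using s by simp
  have "(int q * flux p c x) mod int s = (flux p c x * flux p c x * v) mod int s"
    unfolding q by (simp add: mod_simps algebra_simps)
  also have "\<dots> = v" using fl v by auto
  finally have "(int q * flux p c x) mod int s = v" .
  then have "(skew s p c ^^ (card (orbit p x) * q)) (x, 0) = (x, v)"
    using funpow_skew[where u = 0 and s = s and p = p and c = c] s sum_along_orbit[OF p x] orbit_period[OF p x] by simp
  then show ?thesis by blast
qed

section \<open>Cyclic covers ramified over two places\<close>

text \<open>
  The three permutations of a constellation: black vertices, white vertices, faces.  A place is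
  a cycle of one of them and is named by an index \<open>k < 3\<close> together with a point of the cycle.
\<close>

definition gen :: "('a \<Rightarrow> 'a) \<Rightarrow> ('a \<Rightarrow> 'a) \<Rightarrow> nat \<Rightarrow> 'a \<Rightarrow> 'a" where
  "gen a b k = (if k = 0 then a else if k = 1 then b else a \<circ> b)"

definition place_ind :: "('a \<Rightarrow> 'a) \<Rightarrow> ('a \<Rightarrow> 'a) \<Rightarrow> nat \<Rightarrow> 'a \<Rightarrow> nat \<Rightarrow> 'a \<Rightarrow> int" where
  "place_ind a b i x k z = of_bool (k = i \<and> z \<in> orbit (gen a b i) x)"

text \<open>
  The cocycles of the three permutations, normalised to add up to zero along \<open>y \<mapsto> b y \<mapsto> a (b y)\<close>;
  those of \<open>a\<close> and \<open>b\<close> can be chosen freely.  The third one is the negative of the shift of the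
  composed skew product, which makes the total flux over all places vanish.
\<close>

definition sum_fun :: "('a \<Rightarrow> 'a) \<Rightarrow> ('a \<Rightarrow> int) \<Rightarrow> ('a \<Rightarrow> int) \<Rightarrow> nat \<Rightarrow> 'a \<Rightarrow> int" where
  "sum_fun b c d k = (if k = 0 then c else if k = 1 then d else (\<lambda>y. - d y - c (b y)))"

text \<open>
  Some cocycle has flux \<open>1\<close> at the first place, \<open>-1\<close> at the second one and \<open>0\<close> everywhere else.
  Topologically the cover is slit along a path that joins the two places.
\<close>

definition linked :: "'a set \<Rightarrow> ('a \<Rightarrow> 'a) \<Rightarrow> ('a \<Rightarrow> 'a) \<Rightarrow> nat \<times> 'a \<Rightarrow> nat \<times> 'a \<Rightarrow> bool" where
  "linked A a b = (\<lambda>(i, x) (j, y). \<exists>c d. \<forall>k<3. \<forall>z\<in>A.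
     flux (gen a b k) (sum_fun b c d k) z = place_ind a b i x k z - place_ind a b j y k z)"

lemma perm_on_gen: "constellation A a b \<Longrightarrow> perm_on A (gen a b k)"
  using constellationD(1-3) unfolding gen_def by metis

lemma linked_sym:
  assumes "linked A a b P Q"
  shows "linked A a b Q P"
proof -
  obtain i x j y where P: "P = (i, x)" "Q = (j, y)" by (cases P, cases Q)
  obtain c d where cd: "\<And>k z. k < 3 \<Longrightarrow> z \<in> A \<Longrightarrow>
      flux (gen a b k) (sum_fun b c d k) z = place_ind a b i x k z - place_ind a b j y k z"
    using assms unfolding linked_def P by auto
  have "flux (gen a b k) (sum_fun b (\<lambda>z. - c z) (\<lambda>z. - d z) k) z
      = - flux (gen a b k) (sum_fun b c d k) z" for k z
    unfolding flux_def sum_negf[symmetric] by (rule sum.cong) (simp_all add: sum_fun_def)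
  then have "\<forall>k<3. \<forall>z\<in>A. flux (gen a b k) (sum_fun b (\<lambda>z. - c z) (\<lambda>z. - d z) k) z
      = place_ind a b j y k z - place_ind a b i x k z" by (simp add: cd)
  then show ?thesis unfolding linked_def P prod.case
    by (rule exI[of _ "\<lambda>z. - c z", OF exI[of _ "\<lambda>z. - d z"]])
qed

lemma linked_trans [trans]:
  assumes "linked A a b P Q" "linked A a b Q R"
  shows "linked A a b P R"
proof -
  obtain i x j y l w where P: "P = (i, x)" "Q = (j, y)" "R = (l, w)"
    by (cases P, cases Q, cases R)
  obtain c d where cd: "\<And>k z. k < 3 \<Longrightarrow> z \<in> A \<Longrightarrow>
      flux (gen a b k) (sum_fun b c d k) z = place_ind a b i x k z - place_ind a b j y k z"
    using assms(1) unfolding linked_def P by auto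
  obtain c' d' where cd': "\<And>k z. k < 3 \<Longrightarrow> z \<in> A \<Longrightarrow>
      flux (gen a b k) (sum_fun b c' d' k) z = place_ind a b j y k z - place_ind a b l w k z"
    using assms(2) unfolding linked_def P by auto
  have "flux (gen a b k) (sum_fun b (\<lambda>z. c z + c' z) (\<lambda>z. d z + d' z) k) z
      = flux (gen a b k) (sum_fun b c d k) z + flux (gen a b k) (sum_fun b c' d' k) z" for k z
    unfolding flux_def sum.distrib[symmetric] by (rule sum.cong) (simp_all add: sum_fun_def)
  then have "\<forall>k<3. \<forall>z\<in>A. flux (gen a b k) (sum_fun b (\<lambda>z. c z + c' z) (\<lambda>z. d z + d' z) k) z
      = place_ind a b i x k z - place_ind a b l w k z" by (simp add: cd cd')
  then show ?thesis unfolding linked_def P prod.case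
    by (rule exI[of _ "\<lambda>z. c z + c' z", OF exI[of _ "\<lambda>z. d z + d' z"]])
qed

lemma orbit_mem_sym:
  assumes "perm_on A p" "x \<in> A" "y \<in> A"
  shows "x \<in> orbit p y \<longleftrightarrow> y \<in> orbit p x"
  using orbit_eq[OF assms(1)] self_in_orbit[OF assms(1)] assms(2,3) by metis

lemma less_3_cases: "k < 3 \<Longrightarrow> k = 0 \<or> k = 1 \<or> k = (2::nat)"
  by linarith

lemma linked_same_place:
  assumes A: "constellation A a b" and x: "x \<in> A"
  shows "linked A a b (i, x) (i, gen a b i x)"
proof -
  have "orbit (gen a b i) (gen a b i x) = orbit (gen a b i) x"
    using orbit_eq[OF perm_on_gen[OF A] x orbit.base] .
  then show ?thesis unfolding linked_def place_ind_def flux_def sum_fun_def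
    by (auto intro!: exI[of _ "\<lambda>_. 0"])
qed

text \<open>
  The cocycle of \<open>b\<close> is the indicator of the edge \<open>e\<close>, and that of \<open>a\<close> vanishes.
\<close>

lemma linked_white_face:
  assumes A: "constellation A a b" and e: "e \<in> A"
  shows "linked A a b (1, e) (2, e)"
proof -
  let ?d = "\<lambda>y. of_bool (y = e) :: int"
  have fl: "flux p ?d z = of_bool (z \<in> orbit p e)" if "perm_on A p" "z \<in> A" for p z
    unfolding flux_def
    using orbit_mem_sym[OF that(1) e that(2)] finite_orbit_on[OF that] by (simp add: of_bool_def)
  have neg: "flux p (\<lambda>y. - ?d y) z = - flux p ?d z" for p z
    unfolding flux_def by (rule sum_negf)
  have "flux (gen a b k) (sum_fun b (\<lambda>_. 0) ?d k) z = place_ind a b 1 e k z - place_ind a b 2 e k z"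
    if k: "k < 3" and z: "z \<in> A" for k z
    using less_3_cases[OF k] fl[OF constellationD(2)[OF A] z] fl[OF constellationD(3)[OF A] z]
      neg[of "a \<circ> b" z]
    by (elim disjE) (simp_all add: sum_fun_def gen_def place_ind_def flux_def)
  then show ?thesis unfolding linked_def by blast
qed

text \<open>
  The cocycle of \<open>a\<close> is the indicator of the edge \<open>b e\<close>, and that of \<open>b\<close> vanishes.
\<close>

lemma linked_black_face:
  assumes A: "constellation A a b" and e: "e \<in> A"
  shows "linked A a b (0, b e) (2, e)"
proof -
  note AD = constellationD[OF A]
  let ?c = "\<lambda>y. of_bool (y = b e) :: int"
  have 0: "flux a ?c z = of_bool (z \<in> orbit a (b e))" if "z \<in> A" for z
    unfolding flux_def
    using orbit_mem_sym[OF AD(1) AD(7)[OF e] that] finite_orbit_on[OF AD(1) that]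
    by (simp add: of_bool_def)
  have 2: "flux (a \<circ> b) (\<lambda>y. - ?c (b y)) z = - of_bool (z \<in> orbit (a \<circ> b) e)" if z: "z \<in> A" for z
  proof -
    have "flux (a \<circ> b) (\<lambda>y. - ?c (b y)) z = - (\<Sum>y\<in>orbit (a \<circ> b) z. of_bool (y = e))"
      unfolding flux_def sum_negf[symmetric]
    proof (rule sum.cong[OF refl])
      fix y assume "y \<in> orbit (a \<circ> b) z"
      then have "y \<in> A" using orbit_in[OF AD(3) z] by blast
      then have "b y = b e \<longleftrightarrow> y = e" using inj_on_eq_iff[OF perm_on_inj[OF AD(2)] _ e] by blast
      then show "- ?c (b y) = - of_bool (y = e)" by simp
    qed
    then show ?thesis
      using orbit_mem_sym[OF AD(3) e z] finite_orbit_on[OF AD(3) z] by (simp add: of_bool_def)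
  qed
  have "flux (gen a b k) (sum_fun b ?c (\<lambda>_. 0) k) z
      = place_ind a b 0 (b e) k z - place_ind a b 2 e k z"
    if k: "k < 3" and z: "z \<in> A" for k z
    using less_3_cases[OF k] 0[OF z] 2[OF z]
    by (elim disjE) (simp_all add: sum_fun_def gen_def place_ind_def flux_def[of b])
  then show ?thesis unfolding linked_def by blast
qed

text \<open>
  Cocycles can be added, so being linked is transitive; the elementary cocycles link the places
  at a common edge, and transitivity of the constellation links all of them.
\<close>

lemma all_linked:
  assumes A: "constellation A a b" and "x \<in> A" "y \<in> A" "i < 3" "j < 3"
  shows "linked A a b (i, x) (j, y)"
proof -
  note AD = constellationD[OF A]
  have bw_b: "linked A a b (0, b e) (1, b e)" if e: "e \<in> A" for e
  proof -
    have "linked A a b (0, b e) (2, e)" by (rule linked_black_face[OF A e])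
    also have "linked A a b (2, e) (1, e)" by (rule linked_sym[OF linked_white_face[OF A e]])
    also have "linked A a b (1, e) (1, b e)" using linked_same_place[OF A e, of 1] by (simp add: gen_def)
    finally show ?thesis .
  qed
  have bw: "linked A a b (0, e) (1, e)" if e: "e \<in> A" for e
  proof -
    have "b ` A = A" using AD(2) unfolding perm_on_def bij_betw_def by blast
    then obtain e' where "e' \<in> A" "e = b e'" using e by blast
    then show ?thesis using bw_b by simp
  qed
  have refl: "linked A a b (k, z) (k, z)" for k z
    unfolding linked_def flux_def sum_fun_def by (auto intro!: exI[of _ "\<lambda>_. 0"])
  have down: "linked A a b (k, z) (0, z)" if "z \<in> A" "k < 3" for k z
    using less_3_cases[OF that(2)]
  proof (elim disjE)
    assume "k = 2"
    have "linked A a b (2, z) (1, z)" by (rule linked_sym[OF linked_white_face[OF A that(1)]])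
    also have "linked A a b (1, z) (0, z)" by (rule linked_sym[OF bw[OF that(1)]])
    finally show ?thesis using \<open>k = 2\<close> by simp
  qed (use refl linked_sym[OF bw[OF that(1)]] in simp_all)
  have "linked A a b (0, x) (0, y)"
    using A assms(2,3)
  proof (induction rule: constellation_induct)
    case (left z)
    have "linked A a b (0, z) (0, a z)"
      using linked_same_place[OF A left(1), of 0] by (simp add: gen_def)
    with left(2) show ?case by (rule linked_trans)
  next
    case (right z)
    note right(2)
    also have "linked A a b (0, z) (1, z)" using bw[OF right(1)] .
    also have "linked A a b (1, z) (1, b z)"
      using linked_same_place[OF A right(1), of 1] by (simp add: gen_def)
    also have "linked A a b (1, b z) (0, b z)" using linked_sym[OF bw[OF AD(7)[OF right(1)]]] .
    finally show ?case .
  qed (rule refl)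
  then show ?thesis
    using down[OF assms(2,4)] linked_sym[OF down[OF assms(3,5)]] linked_trans by blast
qed

lemma gen_joint: "z \<in> joint a b x \<Longrightarrow> gen a b k z \<in> joint a b x"
  unfolding gen_def using joint.left[of z a b x] joint.right[of z a b x] joint.left[of "b z" a b x]
  by simp

lemma funpow_joint: "z \<in> joint a b x \<Longrightarrow> (gen a b k ^^ n) z \<in> joint a b x"
  by (induction n) (simp_all add: gen_joint)

text \<open>
  The skew product for a cocycle that links the two places.  It is transitive: the sheets over \<open>x\<close>
  are joined by turning around the place of \<open>x\<close>, and from there the constellation below reaches
  every fibre.
\<close>

theorem cyclic_cover:
  assumes A: "constellation A a b" and xy: "x \<in> A" "y \<in> A" and ij: "i < 3" "j < 3"
    and ne: "\<not> (i = j \<and> y \<in> orbit (gen a b i) x)" and s: "s > 0"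
  obtains \<alpha> \<beta> :: "'a \<times> int \<Rightarrow> 'a \<times> int" where "constellation (A \<times> {0..<int s}) \<alpha> \<beta>"
    "\<And>k z u. k < 3 \<Longrightarrow> z \<in> A \<Longrightarrow> u \<in> {0..<int s} \<Longrightarrow>
       card (orbit (gen \<alpha> \<beta> k) (z, u)) = card (orbit (gen a b k) z) *
         (if k = i \<and> z \<in> orbit (gen a b i) x \<or> k = j \<and> z \<in> orbit (gen a b j) y then s else 1)"
proof -
  note AD = constellationD[OF A]
  obtain c d where cd: "\<And>k z. k < 3 \<Longrightarrow> z \<in> A \<Longrightarrow>
      flux (gen a b k) (sum_fun b c d k) z = place_ind a b i x k z - place_ind a b j y k z"
    using all_linked[OF A xy ij] unfolding linked_def by auto
  \<comment> \<open>The shifts of the skew products themselves: for the faces, \<open>sum_fun\<close> has the opposite sign.\<close>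
  define cc where "cc k = (if k = 2 then (\<lambda>z. d z + c (b z)) else sum_fun b c d k)" for k :: nat
  define \<alpha> where "\<alpha> = skew s a c"
  define \<beta> where "\<beta> = skew s b d"
  have gen_skew: "gen \<alpha> \<beta> k = skew s (gen a b k) (cc k)" if "k < 3" for k
    using less_3_cases[OF that] unfolding \<alpha>_def \<beta>_def cc_def
    by (elim disjE) (simp_all add: gen_def sum_fun_def skew_comp)
  have disj: "\<not> (k = i \<and> z \<in> orbit (gen a b i) x \<and> k = j \<and> z \<in> orbit (gen a b j) y)"
    if "z \<in> A" for k z
    using ne orbit_eq[OF perm_on_gen[OF A]] self_in_orbit[OF perm_on_gen[OF A]] xy that by metis
  have fl_abs: "flux (gen a b k) (cc k) z = flux (gen a b k) (sum_fun b c d k) z \<or>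
      flux (gen a b k) (cc k) z = - flux (gen a b k) (sum_fun b c d k) z" for k z
    unfolding cc_def flux_def sum_negf[symmetric]
    by (cases "k = 2") (simp_all add: sum_fun_def add.commute)
  have fl: "flux (gen a b k) (cc k) z \<in> {-1, 0, 1}"
    "flux (gen a b k) (cc k) z \<noteq> 0 \<longleftrightarrow>
      k = i \<and> z \<in> orbit (gen a b i) x \<or> k = j \<and> z \<in> orbit (gen a b j) y"
    if "k < 3" "z \<in> A" for k z
  proof -
    have *: "flux (gen a b k) (sum_fun b c d k) z =
        of_bool (k = i \<and> z \<in> orbit (gen a b i) x) - of_bool (k = j \<and> z \<in> orbit (gen a b j) y)"
      using cd[OF that] unfolding place_ind_def .
    then have "flux (gen a b k) (sum_fun b c d k) z \<in> {-1, 0, 1}" by (simp add: of_bool_def)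
    then show "flux (gen a b k) (cc k) z \<in> {-1, 0, 1}" using fl_abs[of k z] by auto
    have "flux (gen a b k) (cc k) z \<noteq> 0 \<longleftrightarrow> flux (gen a b k) (sum_fun b c d k) z \<noteq> 0"
      using fl_abs[of k z] by linarith
    also have "\<dots> \<longleftrightarrow> k = i \<and> z \<in> orbit (gen a b i) x \<or> k = j \<and> z \<in> orbit (gen a b j) y"
      unfolding * using disj[OF that(2), of k] by (simp add: of_bool_def)
    finally show "flux (gen a b k) (cc k) z \<noteq> 0 \<longleftrightarrow>
      k = i \<and> z \<in> orbit (gen a b i) x \<or> k = j \<and> z \<in> orbit (gen a b j) y" .
  qed
  have perm: "perm_on (A \<times> {0..<int s}) \<alpha>" "perm_on (A \<times> {0..<int s}) \<beta>"
    unfolding \<alpha>_def \<beta>_def using perm_on_skew[OF _ s] AD by blast+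
  let ?J = "joint \<alpha> \<beta> (x, 0)"
  have fibre: "(x, v) \<in> ?J" if v: "v \<in> {0..<int s}" for v
  proof -
    have "flux (gen a b i) (cc i) x \<in> {-1, 1}"
      using fl[OF ij(1) xy(1)] self_in_orbit[OF perm_on_gen[OF A] xy(1)] by auto
    then obtain n where "(gen \<alpha> \<beta> i ^^ n) (x, 0) = (x, v)"
      using skew_fibre_reachable[OF perm_on_gen[OF A] xy(1) _ v] unfolding gen_skew[OF ij(1)] by metis
    then show ?thesis using funpow_joint[OF joint.base] by metis
  qed
  have "\<forall>v\<in>{0..<int s}. (z, v) \<in> ?J" if "z \<in> A" for z
    using A xy(1) that
  proof (induction rule: constellation_induct)
    case (left z)
    show ?case
    proof
      fix v assume v: "v \<in> {0..<int s}"
      have "(z, (v - c z) mod int s) \<in> ?J" using left s by simp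
      then have "\<alpha> (z, (v - c z) mod int s) \<in> ?J" by (rule joint.left)
      then show "(a z, v) \<in> ?J" unfolding \<alpha>_def skew_def using v by (simp add: mod_simps)
    qed
  next
    case (right z)
    show ?case
    proof
      fix v assume v: "v \<in> {0..<int s}"
      have "(z, (v - d z) mod int s) \<in> ?J" using right s by simp
      then have "\<beta> (z, (v - d z) mod int s) \<in> ?J" by (rule joint.right)
      then show "(b z, v) \<in> ?J" unfolding \<beta>_def skew_def using v by (simp add: mod_simps)
    qed
  qed (use fibre in blast)
  then have "constellation (A \<times> {0..<int s}) \<alpha> \<beta>"
    by (intro constellationI[OF perm, of "(x, 0)"]) (use xy s in auto)
  moreover have "card (orbit (gen \<alpha> \<beta> k) (z, u)) = card (orbit (gen a b k) z) *
         (if k = i \<and> z \<in> orbit (gen a b i) x \<or> k = j \<and> z \<in> orbit (gen a b j) y then s else 1)"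
    if "k < 3" "z \<in> A" "u \<in> {0..<int s}" for k z u
    unfolding gen_skew[OF that(1)] card_orbit_skew[OF perm_on_gen[OF A] that(2,3) fl(1)[OF that(1,2)]]
    using fl(2)[OF that(1,2)] by auto
  ultimately show thesis using that by blast
qed

section \<open>The Platonic constellations\<close>

lemma ctype_const:
  assumes p: "perm_on A p" and len: "\<And>x. x \<in> A \<Longrightarrow> card (orbit p x) = L"
    and A: "card A = n * L" "L > 0"
  shows "ctype A p = replicate_mset n L"
proof -
  have "x = L" if "x \<in># ctype A p" for x
    using that len unfolding set_ctype[OF perm_on_finite[OF p]] by auto
  then obtain k where k: "ctype A p = replicate_mset k L"
    using set_mset_subset_singletonD[of "ctype A p" L] by blast
  then have "k * L = n * L" using sum_ctype[OF p] A(1) by simp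
  then show ?thesis using k A(2) by simp
qed

text \<open>
  The equation says that the constellation is planar.
\<close>

definition platonic_realized :: "nat \<Rightarrow> nat \<Rightarrow> nat \<Rightarrow> bool" where
  "platonic_realized k m l \<longleftrightarrow> (\<exists>p q r. p + q + r = p * k + 2 \<and>
     realized (replicate_mset p k) (replicate_mset q m) (replicate_mset r l))"

text \<open>
  Dividing a Platonic constellation by the rotations about an axis leaves a small one in which the
  two poles of the axis have become fixed points; the cyclic cover ramified over the poles recovers
  the original.
\<close>

lemma platonic_of_quotient:
  fixes L :: "nat \<Rightarrow> nat"
  assumes A: "constellation A a b" and xy: "x \<in> A" "y \<in> A" and ij: "i < 3" "j < 3"
    and ne: "(i, x) \<noteq> (j, y)" and fixed: "gen a b i x = x" "gen a b j y = y"
    and s: "s > 0" "L i = s" "L j = s"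
    and len: "\<And>t z. t < 3 \<Longrightarrow> z \<in> A \<Longrightarrow> (t, z) \<noteq> (i, x) \<Longrightarrow> (t, z) \<noteq> (j, y) \<Longrightarrow>
      card (orbit (gen a b t) z) = L t"
    and num: "card A * s = p * L 0" "card A * s = q * L 1" "card A * s = r * L 2"
      "p + q + r = p * L 0 + 2"
  shows "platonic_realized (L 0) (L 1) (L 2)"
proof -
  have orb: "orbit (gen a b i) x = {x}" "orbit (gen a b j) y = {y}"
    using fixed by (simp_all add: orbit_eq_singleton_iff)
  obtain \<alpha> \<beta> :: "'a \<times> int \<Rightarrow> 'a \<times> int" where C: "constellation (A \<times> {0..<int s}) \<alpha> \<beta>"
    and cl: "\<And>k z u. k < 3 \<Longrightarrow> z \<in> A \<Longrightarrow> u \<in> {0..<int s} \<Longrightarrow>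
       card (orbit (gen \<alpha> \<beta> k) (z, u)) = card (orbit (gen a b k) z) *
         (if k = i \<and> z \<in> orbit (gen a b i) x \<or> k = j \<and> z \<in> orbit (gen a b j) y then s else 1)"
    by (rule cyclic_cover[OF A xy ij _ s(1)]) (use ne orb in auto)
  have len': "card (orbit (gen \<alpha> \<beta> t) w) = L t" if "t < 3" "w \<in> A \<times> {0..<int s}" for t w
  proof -
    obtain z u where w: "w = (z, u)" by force
    show ?thesis
      using cl[OF that(1), of z u] that(2) len[OF that(1), of z] s(2,3) orb unfolding w
      by (cases "(t, z) = (i, x) \<or> (t, z) = (j, y)") auto
  qed
  have Lpos: "L t > 0" if "t < 3" for t
    using len'[OF that, of "(x, 0)"] xy(1) s(1)
      card_orbit_pos[OF perm_on_gen[OF C, of t], of "(x, 0)"] by simp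
  have card: "card (A \<times> {0..<int s}) = card A * s" by (simp add: card_cartesian_product)
  have ct: "ctype (A \<times> {0..<int s}) (gen \<alpha> \<beta> t) = replicate_mset n (L t)"
    if "t < 3" "card A * s = n * L t" for t n
    by (rule ctype_const[OF perm_on_gen[OF C] len'[OF that(1)]]) (use card that Lpos in auto)
  have "realized (replicate_mset p (L 0)) (replicate_mset q (L 1)) (replicate_mset r (L 2))"
    using constellation_realized[OF C] ct[of 0 p] ct[of 1 q] ct[of 2 r] num by (simp add: gen_def)
  then show ?thesis unfolding platonic_realized_def using num(4) by blast
qed

lemma card_orbit_checkI:
  assumes "perm_on A p" "x \<in> A" "(p ^^ k) x = x" "k > 0"
    and "\<forall>j \<in> set [1..<k]. (p ^^ j) x \<noteq> x"
  shows "card (orbit p x) = k"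
proof (rule ccontr)
  let ?L = "card (orbit p x)"
  assume "?L \<noteq> k"
  moreover have "?L dvd k" using assms(3) orbit_period[OF assms(1,2)] by simp
  ultimately have "?L < k" using assms(4) dvd_imp_le le_neq_implies_less by blast
  moreover have "(p ^^ ?L) x = x" using orbit_period[OF assms(1,2), of ?L] by simp
  moreover have "?L > 0" using card_orbit_pos[OF assms(1,2)] .
  ultimately show False using assms(5) by auto
qed

text \<open>
  An executable approximation from below of the joint orbits of two permutations given as lists.
\<close>

fun reach_list :: "nat \<Rightarrow> nat list \<Rightarrow> nat list \<Rightarrow> nat list \<Rightarrow> nat list" where
  "reach_list 0 xs ys zs = zs"
| "reach_list (Suc n) xs ys zs = reach_list n xs ys (remdups (zs @ map ((!) xs) zs @ map ((!) ys) zs))"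

lemma reach_list_joint:
  "set zs \<subseteq> joint ((!) xs) ((!) ys) x \<Longrightarrow> set (reach_list n xs ys zs) \<subseteq> joint ((!) xs) ((!) ys) x"
proof (induction n arbitrary: zs)
  case (Suc n)
  show ?case unfolding reach_list.simps
  proof (rule Suc.IH, rule subsetI)
    fix z assume "z \<in> set (remdups (zs @ map ((!) xs) zs @ map ((!) ys) zs))"
    then consider "z \<in> set zs" | w where "w \<in> set zs" "z = xs ! w" | w where "w \<in> set zs" "z = ys ! w"
      by auto
    then show "z \<in> joint ((!) xs) ((!) ys) x"
    proof cases
      case 2
      then show ?thesis using Suc.prems joint.left[of w "(!) xs" "(!) ys" x] by blast
    next
      case 3
      then show ?thesis using Suc.prems joint.right[of w "(!) xs" "(!) ys" x] by blast
    qed (use Suc.prems in blast)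
  qed
qed simp

definition list_constellation :: "nat \<Rightarrow> nat list \<Rightarrow> nat list \<Rightarrow> bool" where
  "list_constellation N xs ys \<longleftrightarrow> N > 0 \<and> length xs = N \<and> length ys = N \<and>
     distinct xs \<and> distinct ys \<and> list_all (\<lambda>x. x < N) xs \<and> list_all (\<lambda>x. x < N) ys \<and>
     list_all (\<lambda>x. x \<in> set (reach_list N xs ys [0])) [0..<N]"

lemma list_constellationD:
  assumes "list_constellation N xs ys"
  shows "constellation (set [0..<N]) ((!) xs) ((!) ys)"
proof -
  have perm: "perm_on (set [0..<N]) ((!) zs)"
    if "length zs = N" "distinct zs" "list_all (\<lambda>x. x < N) zs" for zs
    by (rule perm_onI) (use that in \<open>auto simp: list_all_iff inj_on_def nth_eq_iff_index_eq\<close>)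
  show ?thesis
  proof (rule constellationI)
    show "perm_on (set [0..<N]) ((!) xs)" "perm_on (set [0..<N]) ((!) ys)"
      using assms perm unfolding list_constellation_def by auto
    show "0 \<in> set [0..<N]" using assms unfolding list_constellation_def by simp
    show "set [0..<N] \<subseteq> joint ((!) xs) ((!) ys) 0"
    proof
      fix z assume "z \<in> set [0..<N]"
      then have "z \<in> set (reach_list N xs ys [0])"
        using assms unfolding list_constellation_def list_all_iff by blast
      moreover have "set (reach_list N xs ys [0]) \<subseteq> joint ((!) xs) ((!) ys) 0"
        by (rule reach_list_joint) (simp add: joint.base)
      ultimately show "z \<in> joint ((!) xs) ((!) ys) 0" by blast
    qed
  qed
qed

text \<open>
  An executable form of the hypotheses of \<open>platonic_of_quotient\<close> on fixed points and cycle lengths.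
\<close>

definition quotient_check ::
    "nat \<Rightarrow> nat list \<Rightarrow> nat list \<Rightarrow> nat \<times> nat \<Rightarrow> nat \<times> nat \<Rightarrow> nat list \<Rightarrow> bool" where
  "quotient_check N xs ys P Q L \<longleftrightarrow>
     (\<forall>t \<in> set [0..<3]. \<forall>z \<in> set [0..<N].
        let g = gen ((!) xs) ((!) ys) t in
        if (t, z) = P \<or> (t, z) = Q then g z = z
        else 0 < L ! t \<and> (g ^^ (L ! t)) z = z \<and> (\<forall>j \<in> set [1..<L ! t]. (g ^^ j) z \<noteq> z))"

lemma platonic_of_list_quotient:
  assumes C: "list_constellation N xs ys" and chk: "quotient_check N xs ys (i, x) (j, y) [k, m, l]"
    and xy: "x < N" "y < N" "i < 3" "j < 3" "(i, x) \<noteq> (j, y)" "s > 0" "[k, m, l] ! i = s" "[k, m, l] ! j = s"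
    and num: "N * s = p * k" "N * s = q * m" "N * s = r * l" "p + q + r = p * k + 2"
  shows "platonic_realized k m l"
proof -
  note A = list_constellationD[OF C]
  let ?L = "\<lambda>t. [k, m, l] ! t"
  have chk': "if (t, z) = (i, x) \<or> (t, z) = (j, y) then gen ((!) xs) ((!) ys) t z = z
        else 0 < ?L t \<and> (gen ((!) xs) ((!) ys) t ^^ ?L t) z = z \<and>
          (\<forall>j \<in> set [1..<?L t]. (gen ((!) xs) ((!) ys) t ^^ j) z \<noteq> z)" if "t < 3" "z < N" for t z
    using chk that unfolding quotient_check_def Let_def by auto
  have "platonic_realized (?L 0) (?L 1) (?L 2)"
  proof (rule platonic_of_quotient[OF A, of x y i j s ?L p q r])
    fix t z assume tz: "t < 3" "z \<in> set [0..<N]" "(t, z) \<noteq> (i, x)" "(t, z) \<noteq> (j, y)"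
    show "card (orbit (gen ((!) xs) ((!) ys) t) z) = ?L t"
      by (rule card_orbit_checkI[OF perm_on_gen[OF A] tz(2)]) (use chk'[of t z] tz in auto)
  next
    show "gen ((!) xs) ((!) ys) i x = x" "gen ((!) xs) ((!) ys) j y = y"
      using chk'[of i x] chk'[of j y] xy by simp_all
  qed (use xy num in simp_all)
  then show ?thesis by (simp add: numeral_2_eq_2)
qed

text \<open>
  The quotient by the rotations of order \<open>r\<close> has two edges, which join the same two vertices, and
  two faces, the poles of the axis.
\<close>

lemma platonic_dihedral:
  assumes r: "r \<ge> 2"
  shows "platonic_realized 2 2 r"
proof -
  let ?w = "(!) [1, 0 :: nat]" and ?A = "set [0..<2]"
  let ?L = "\<lambda>t :: nat. if t < 2 then 2 else r"
  have C: "constellation ?A ?w ?w" by (rule list_constellationD) code_simp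
  have "platonic_realized (?L 0) (?L 1) (?L 2)"
  proof (rule platonic_of_quotient[OF C, of 0 1 2 2 r ?L r r 2])
    show "gen ?w ?w 2 0 = 0" "gen ?w ?w 2 1 = 1" by code_simp+
    fix t z :: nat
    assume t: "t < 3" and z: "z \<in> ?A" "(t, z) \<noteq> (2, 0)" "(t, z) \<noteq> (2, 1)"
    have "z = 0 \<or> z = 1" using z(1) by auto
    then have t2: "t = 0 \<or> t = 1" using z less_3_cases[OF t] by auto
    then have "gen ?w ?w t = ?w" by (auto simp: gen_def)
    moreover have "card (orbit ?w z) = 2"
      by (rule card_orbit_checkI[OF constellationD(1)[OF C] z(1)])
        (use \<open>z = 0 \<or> z = 1\<close> in \<open>auto simp: numeral_2_eq_2 upt_rec\<close>)
    ultimately show "card (orbit (gen ?w ?w t) z) = ?L t" using t2 by auto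
  qed (use r in simp_all)
  then show ?thesis by simp
qed

text \<open>
  Four edges with cycle types \<open>(2,2)\<close>, \<open>(3,1)\<close>, \<open>(3,1)\<close>: the axis of order 3 joins a white vertex to
  the opposite face.
\<close>

lemma platonic_tetrahedral: "platonic_realized 2 3 3"
proof (rule platonic_of_list_quotient[where N = 4 and xs = "[3, 2, 1, 0]" and ys = "[1, 2, 0, 3]"
      and i = 1 and x = 3 and j = 2 and y = 1 and s = 3 and p = 6 and q = 4 and r = 4])
  show "list_constellation 4 [3, 2, 1, 0] [1, 2, 0, 3]" by code_simp
  show "quotient_check 4 [3, 2, 1, 0] [1, 2, 0, 3] (1, 3) (2, 1) [2, 3, 3]" by code_simp
qed simp_all

text \<open>
  Six edges with cycle types \<open>(2,2,2)\<close>, \<open>(3,3)\<close>, \<open>(4,1,1)\<close>: the axis of order 4 joins two faces.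
\<close>

lemma platonic_octahedral: "platonic_realized 2 3 4"
proof (rule platonic_of_list_quotient[where N = 6 and xs = "[1, 0, 5, 4, 3, 2]"
      and ys = "[1, 2, 0, 4, 5, 3]"
      and i = 2 and x = 0 and j = 2 and y = 3 and s = 4 and p = 12 and q = 8 and r = 6])
  show "list_constellation 6 [1, 0, 5, 4, 3, 2] [1, 2, 0, 4, 5, 3]" by code_simp
  show "quotient_check 6 [1, 0, 5, 4, 3, 2] [1, 2, 0, 4, 5, 3] (2, 0) (2, 3) [2, 3, 4]" by code_simp
qed simp_all

text \<open>
  Twelve edges with cycle types \<open>(2,...,2)\<close>, \<open>(3,3,3,3)\<close>, \<open>(5,5,1,1)\<close>: the axis of order 5 joins two
  faces.  Seen as a cubic graph whose edges carry the black vertices, the quotient is a double edge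
  with a stalk attached at each end, on opposite sides, and a loop at the tip of each stalk; the
  loops bound the two poles.
\<close>

lemma platonic_icosahedral: "platonic_realized 2 3 5"
proof (rule platonic_of_list_quotient[where N = 12 and xs = "[1, 0, 6, 4, 3, 9, 2, 10, 11, 5, 7, 8]"
      and ys = "[1, 2, 0, 4, 5, 3, 7, 8, 6, 10, 11, 9]"
      and i = 2 and x = 0 and j = 2 and y = 3 and s = 5 and p = 30 and q = 20 and r = 12])
  show "list_constellation 12 [1, 0, 6, 4, 3, 9, 2, 10, 11, 5, 7, 8]
      [1, 2, 0, 4, 5, 3, 7, 8, 6, 10, 11, 9]" by code_simp
  show "quotient_check 12 [1, 0, 6, 4, 3, 9, 2, 10, 11, 5, 7, 8]
      [1, 2, 0, 4, 5, 3, 7, 8, 6, 10, 11, 9] (2, 0) (2, 3) [2, 3, 5]" by code_simp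
qed simp_all

section \<open>Bicolored graphs as constellations\<close>

text \<open>
  Face tracing alternates between the two directions of traversal, and two steps from
  \<open>(e, True)\<close> lead to \<open>((a \<circ> b) e, True)\<close>; so a face is a cycle of \<open>a \<circ> b\<close> together with its
  \<open>b\<close>-image.
\<close>

lemma orbit_face_succ:
  fixes G :: "('v, 'e) pre_digraph" and rot :: "'v \<Rightarrow> 'e \<Rightarrow> 'e"
  defines "a \<equiv> \<lambda>e. rot (tail G e) e" and "b \<equiv> \<lambda>e. rot (head G e) e"
  assumes a: "perm_on E a" and b: "perm_on E b" and e: "e \<in> E"
  shows "orbit (face_succ G rot) (e, True) =
    orbit (a \<circ> b) e \<times> {True} \<union> b ` orbit (a \<circ> b) e \<times> {False}" (is "?L = ?R")
proof -
  let ?f = "face_succ G rot"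
  define c where "c = a \<circ> b"
  let ?C = "orbit c e \<times> {True} \<union> b ` orbit c e \<times> {False}"
  have c: "a (b e) = c e" for e unfolding c_def by simp
  have fs: "?f (e, True) = (b e, False)" "?f (e, False) = (a e, True)" for e
    by (simp_all add: face_succ_def a_def b_def)
  have self: "e \<in> orbit c e" using self_in_orbit[OF perm_on_comp[OF a b] e] unfolding c_def .
  have "?L \<subseteq> ?C"
  proof
    fix x assume "x \<in> ?L"
    then show "x \<in> ?C"
    proof induct
      case base
      then show ?case using imageI[OF self, of b] unfolding fs by blast
    next
      case (step y)
      then consider e' where "y = (e', True)" "e' \<in> orbit c e"
        | e' where "y = (b e', False)" "e' \<in> orbit c e" by auto
      then show ?case
      proof cases
        case 2
        then have "c e' \<in> orbit c e" by (blast intro: orbit.step)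
        then show ?thesis using 2 fs c by simp
      qed (use fs in simp)
    qed
  qed
  have T: "(e', True) \<in> ?L" if "e' \<in> orbit c e" for e'
    using that
  proof induct
    case base
    have "?f (?f (e, True)) \<in> ?L" by (intro orbit.step orbit.base)
    then show ?case using fs c by simp
  next
    case (step y)
    then have "?f (?f (y, True)) \<in> ?L" by (intro orbit.step)
    then show ?case using fs c by simp
  qed
  moreover have "(b e', False) \<in> ?L" if "e' \<in> orbit c e" for e'
    using orbit.step[OF T[OF that]] fs by simp
  ultimately have "?C \<subseteq> ?L" by auto
  with \<open>?L \<subseteq> ?C\<close> show ?thesis unfolding c_def by blast
qed

lemma faces_ctype:
  fixes G :: "('v, 'e) pre_digraph" and rot :: "'v \<Rightarrow> 'e \<Rightarrow> 'e"
  defines "a \<equiv> \<lambda>e. rot (tail G e) e" and "b \<equiv> \<lambda>e. rot (head G e) e"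
  assumes a: "perm_on (arcs G) a" and b: "perm_on (arcs G) b"
  shows "image_mset (\<lambda>f. card f div 2) (mset_set (faces G rot)) = ctype (arcs G) (a \<circ> b)"
    and "card (faces G rot) = ncyc (arcs G) (a \<circ> b)"
proof -
  let ?f = "face_succ G rot" and ?E = "arcs G"
  define \<Phi> where "\<Phi> C = C \<times> {True} \<union> b ` C \<times> {False}" for C
  note ab = perm_on_comp[OF a b]
  have orbT: "orbit ?f (e, True) = \<Phi> (orbit (a \<circ> b) e)" if "e \<in> ?E" for e
    using orbit_face_succ[of ?E rot G] a b that unfolding a_def b_def \<Phi>_def by blast
  have orbF: "orbit ?f (b e, False) = \<Phi> (orbit (a \<circ> b) e)" if "e \<in> ?E" for e
  proof -
    have "(e, True) \<in> orbit ?f (e, True)"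
      using self_in_orbit[OF ab that] unfolding orbT[OF that] \<Phi>_def by simp
    then have "orbit ?f (?f (e, True)) = orbit ?f (e, True)" by (rule self_in_orbit_step)
    then show ?thesis using orbT[OF that] by (simp add: face_succ_def b_def)
  qed
  have "b ` ?E = ?E" using b unfolding perm_on_def bij_betw_def by blast
  then have dom: "?E \<times> UNIV = (\<lambda>e. (e, True)) ` ?E \<union> (\<lambda>e. (b e, False)) ` ?E"
    by (auto simp: image_iff)
  have faces: "faces G rot = \<Phi> ` (orbit (a \<circ> b) ` ?E)"
    unfolding faces_def dom image_Un image_image using orbT orbF by auto
  have inj: "inj_on \<Phi> (orbit (a \<circ> b) ` ?E)"
  proof (rule inj_onI)
    fix C D assume "\<Phi> C = \<Phi> D"
    moreover have "C = {e. (e, True) \<in> \<Phi> C}" for C unfolding \<Phi>_def by auto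
    ultimately show "C = D" by metis
  qed
  show "card (faces G rot) = ncyc ?E (a \<circ> b)"
    unfolding faces ncyc_def by (rule card_image[OF inj])
  show "image_mset (\<lambda>f. card f div 2) (mset_set (faces G rot)) = ctype ?E (a \<circ> b)"
    unfolding faces ctype_def image_mset_mset_set[OF inj, symmetric] image_mset.compositionality
  proof (rule image_mset_cong)
    fix C assume "C \<in># mset_set (orbit (a \<circ> b) ` ?E)"
    then obtain e where e: "e \<in> ?E" "C = orbit (a \<circ> b) e" using perm_on_finite[OF a] by auto
    have "finite C" using finite_orbit_on[OF ab e(1)] e(2) by simp
    moreover have "card (b ` C) = card C"
      using orbit_in[OF ab e(1)] perm_on_inj[OF b] e(2) by (metis card_image inj_on_subset)
    moreover have "card (\<Phi> C) = card (C \<times> {True}) + card (b ` C \<times> {False})"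
      unfolding \<Phi>_def by (rule card_Un_disjoint) (use \<open>finite C\<close> in auto)
    ultimately show "((\<lambda>f. card f div 2) \<circ> \<Phi>) C = card C" by (simp add: card_cartesian_product)
  qed
qed

lemma cyclic_on_perm_on:
  assumes "cyclic_on f S"
  shows "perm_on S f"
proof -
  obtain s where s: "s \<in> S" "S = orbit f s" using assms unfolding cyclic_on_def by blast
  have fin: "finite S" using finite_cyclic_on[OF assms] .
  have "S \<subseteq> f ` S"
  proof
    fix y assume "y \<in> S"
    then have "y \<in> orbit f s" using s by simp
    then show "y \<in> f ` S" by cases (use s in auto)
  qed
  then have "f ` S = S" using cyclic_on_inI[OF assms] by blast
  then show ?thesis using fin eq_card_imp_inj_on[of S f] unfolding perm_on_def bij_betw_def by simp
qed

text \<open>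
  For one colour class, the rotations around all its vertices combine to one permutation of the
  edges, whose cycles are the stars of these vertices.
\<close>

lemma vertex_rotation:
  assumes fin: "finite E" and ends: "\<And>e. e \<in> E \<Longrightarrow> end_of e \<in> V"
    and cyc: "\<And>v. v \<in> V \<Longrightarrow> cyclic_on (rot v) {e \<in> E. end_of e = v}"
  defines "p \<equiv> \<lambda>e. rot (end_of e) e"
  shows "perm_on E p" and "\<And>e. e \<in> E \<Longrightarrow> orbit p e = {e' \<in> E. end_of e' = end_of e}"
    and "ctype E p = image_mset (\<lambda>v. card {e \<in> E. end_of e = v}) (mset_set V)"
    and "ncyc E p = card V"
proof -
  let ?S = "\<lambda>v. {e \<in> E. end_of e = v}"
  have inS: "p e \<in> ?S (end_of e)" if "e \<in> E" for e
    unfolding p_def using cyclic_on_inI[OF cyc[OF ends[OF that]], of e] that by simp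
  show perm: "perm_on E p"
  proof (rule perm_onI[OF fin])
    show "p e \<in> E" if "e \<in> E" for e using inS[OF that] by simp
    show "inj_on p E"
    proof (rule inj_onI)
      fix x y assume xy: "x \<in> E" "y \<in> E" "p x = p y"
      then have "end_of x = end_of y" using inS by (metis (mono_tags, lifting) mem_Collect_eq)
      then show "x = y"
        using inj_onD[OF perm_on_inj[OF cyclic_on_perm_on[OF cyc[OF ends[OF xy(1)]]]], of x y] xy
        unfolding p_def by simp
    qed
  qed
  show orb: "orbit p e = ?S (end_of e)" if "e \<in> E" for e
  proof -
    have e: "e \<in> ?S (end_of e)" using that by simp
    note c = cyc[OF ends[OF that]]
    have "orbit p e = orbit (rot (end_of e)) e"
    proof (rule orbit_cong0[OF e])
      show "p \<in> ?S (end_of e) \<rightarrow> ?S (end_of e)" using inS by auto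
      show "p y = rot (end_of e) y" if "y \<in> ?S (end_of e)" for y using that by (simp add: p_def)
    qed
    then show ?thesis using orbit_cyclic_eq3[OF c e] by simp
  qed
  have ne: "?S v \<noteq> {}" if "v \<in> V" for v using cyc[OF that] unfolding cyclic_on_def by blast
  have img: "orbit p ` E = ?S ` V"
  proof
    show "orbit p ` E \<subseteq> ?S ` V" using orb ends by blast
    show "?S ` V \<subseteq> orbit p ` E"
    proof
      fix C assume "C \<in> ?S ` V"
      then obtain v where v: "v \<in> V" "C = ?S v" by blast
      then obtain e where "e \<in> E" "end_of e = v" using ne by blast
      then show "C \<in> orbit p ` E" using orb v by blast
    qed
  qed
  have inj: "inj_on ?S V"
  proof (rule inj_onI)
    fix v w assume vw: "v \<in> V" "?S v = ?S w"
    obtain e where "e \<in> ?S v" using ne[OF vw(1)] by blast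
    then show "v = w" using vw(2) by auto
  qed
  show "ctype E p = image_mset (\<lambda>v. card (?S v)) (mset_set V)"
    unfolding ctype_def img image_mset_mset_set[OF inj, symmetric]
    by (simp add: image_mset.compositionality comp_def)
  show "ncyc E p = card V" unfolding ncyc_def img by (rule card_image[OF inj])
qed

text \<open>
  From graphs to constellations.  Transitivity comes from connectedness: a joint orbit that contains
  one edge at a vertex contains all of them.
\<close>

context bicolored_graph
begin

lemma edges_at_black: "v \<in> black \<Longrightarrow> edges_at G v = {e \<in> arcs G. tail G e = v}"
  using head_white by (auto simp: edges_at_def)

lemma edges_at_white: "v \<in> white \<Longrightarrow> edges_at G v = {e \<in> arcs G. head G e = v}"
  using tail_black by (auto simp: edges_at_def white_def)

lemma graph_constellation:
  defines "a \<equiv> \<lambda>e. rot (tail G e) e" and "b \<equiv> \<lambda>e. rot (head G e) e"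
  shows "constellation (arcs G) a b"
    and "passport = (ctype (arcs G) a, ctype (arcs G) b, ctype (arcs G) (a \<circ> b), card (arcs G))"
    and "ncyc (arcs G) a + ncyc (arcs G) b + ncyc (arcs G) (a \<circ> b) = card (arcs G) + 2"
proof -
  let ?E = "arcs G"
  have head: "head G e \<in> white" if "e \<in> ?E" for e using that head_white unfolding white_def by simp
  have finV: "finite black" "finite white"
    using finite_subset[OF black_verts] unfolding white_def by simp_all
  have cycB: "cyclic_on (rot v) {e \<in> ?E. tail G e = v}" if "v \<in> black" for v
    using rot_cyclic[of v] black_verts that edges_at_black[OF that] by auto
  have cycW: "cyclic_on (rot v) {e \<in> ?E. head G e = v}" if "v \<in> white" for v
    using rot_cyclic[of v] that edges_at_white[OF that] unfolding white_def by auto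
  have B: "perm_on ?E a" "\<And>e. e \<in> ?E \<Longrightarrow> orbit a e = {e' \<in> ?E. tail G e' = tail G e}"
    "ctype ?E a = image_mset (\<lambda>v. card {e \<in> ?E. tail G e = v}) (mset_set black)"
    "ncyc ?E a = card black"
    unfolding a_def using vertex_rotation[of ?E "tail G" black rot] finite_arcs tail_black cycB
    by blast+
  have W: "perm_on ?E b" "\<And>e. e \<in> ?E \<Longrightarrow> orbit b e = {e' \<in> ?E. head G e' = head G e}"
    "ctype ?E b = image_mset (\<lambda>v. card {e \<in> ?E. head G e = v}) (mset_set white)"
    "ncyc ?E b = card white"
    unfolding b_def using vertex_rotation[of ?E "head G" white rot] finite_arcs head cycW
    by blast+
  note F = faces_ctype[of G rot, folded a_def b_def, OF B(1) W(1)]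
  have "black_partition = ctype ?E a"
    unfolding black_partition_def B(3)
    by (rule image_mset_cong) (use finV edges_at_black in simp)
  moreover have "white_partition = ctype ?E b"
    unfolding white_partition_def W(3)
    by (rule image_mset_cong) (use finV edges_at_white in simp)
  ultimately show "passport = (ctype ?E a, ctype ?E b, ctype ?E (a \<circ> b), card ?E)"
    unfolding passport_def face_partition_def F(1) by simp
  have "card (verts G) = card black + card white"
  proof -
    have "verts G = black \<union> white" "black \<inter> white = {}"
      using black_verts unfolding white_def by auto
    then show ?thesis using card_Un_disjoint[OF finV] by simp
  qed
  then show "ncyc ?E a + ncyc ?E b + ncyc ?E (a \<circ> b) = card ?E + 2"
    using euler_sphere unfolding F(2) B(4) W(4) by linarith
  obtain e0 where e0: "e0 \<in> ?E" using arcs_nonempty by blast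
  let ?J = "joint a b e0"
  have J: "?J \<subseteq> ?E" using joint_subset[OF B(1) W(1) e0] .
  have tailJ: "e' \<in> ?J" if "e \<in> ?J" "e' \<in> ?E" "tail G e' = tail G e" for e e'
  proof -
    have "e' \<in> orbit a e" using B(2)[of e] that J by auto
    also have "\<dots> \<subseteq> joint a b e" by (rule orbit_subset_joint) (rule joint.left)
    also have "\<dots> \<subseteq> ?J" by (rule joint_trans[OF that(1)])
    finally show ?thesis .
  qed
  have headJ: "e' \<in> ?J" if "e \<in> ?J" "e' \<in> ?E" "head G e' = head G e" for e e'
  proof -
    have "e' \<in> orbit b e" using W(2)[of e] that J by auto
    also have "\<dots> \<subseteq> joint a b e" by (rule orbit_subset_joint) (rule joint.right)
    also have "\<dots> \<subseteq> ?J" by (rule joint_trans[OF that(1)])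
    finally show ?thesis .
  qed
  have reach: "edges_at G v \<subseteq> ?J" if "(tail G e0, v) \<in> rtrancl_on (verts G) ((arcs_ends G)\<^sup>s)" for v
    using that
  proof (induction rule: rtrancl_on_induct)
    case base
    show ?case using edges_at_black[OF tail_black[OF e0]] tailJ[OF joint.base] by auto
  next
    case (step y z)
    from step(2) obtain e where e: "e \<in> ?E" "tail G e = y \<and> head G e = z \<or> tail G e = z \<and> head G e = y"
      unfolding symcl_def arcs_ends_conv by auto
    then have "e \<in> edges_at G y" unfolding edges_at_def by auto
    then have "e \<in> ?J" using step by blast
    then show ?case using e(2)
    proof (elim disjE)
      assume eJ: "e \<in> ?J" and z: "tail G e = y \<and> head G e = z"
      then show ?thesis using edges_at_white[of z] head[OF e(1)] headJ[OF eJ] by auto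
    next
      assume eJ: "e \<in> ?J" and z: "tail G e = z \<and> head G e = y"
      then show ?thesis using edges_at_black[of z] tail_black[OF e(1)] tailJ[OF eJ] by auto
    qed
  qed
  have "?E \<subseteq> ?J"
  proof
    fix e assume e: "e \<in> ?E"
    then have "(tail G e0, tail G e) \<in> rtrancl_on (verts G) ((arcs_ends G)\<^sup>s)"
      using connected e0 unfolding connected_conv by simp
    moreover have "e \<in> edges_at G (tail G e)" using e unfolding edges_at_def by simp
    ultimately show "e \<in> ?J" using reach by blast
  qed
  then show "constellation ?E a b" by (rule constellationI[OF B(1) W(1) e0])
qed

end

text \<open>
  From constellations to graphs.  The vertices are the cycles of \<open>a\<close> and \<open>b\<close>, numbered by twice their
  least element, plus one for the white vertices.
\<close>

theorem realized_graph:
  assumes "realized P1 P2 P3" and n: "n = sum_mset P1" "size P1 + size P2 + size P3 = n + 2"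
  obtains G :: "(nat, nat) pre_digraph" and black rot where "bicolored_graph G black rot"
    "bicolored_graph.passport G black rot = (P1, P2, P3, n)"
proof -
  obtain A :: "nat set" and a b where A: "constellation A a b"
    and P: "ctype A a = P1" "ctype A b = P2" "ctype A (a \<circ> b) = P3"
    using assms unfolding realized_def by blast
  note AD = constellationD[OF A]
  define bv where "bv e = 2 * Min (orbit a e)" for e
  define wv where "wv e = 2 * Min (orbit b e) + 1" for e
  define G :: "(nat, nat) pre_digraph" where
    "G = \<lparr> verts = bv ` A \<union> wv ` A, arcs = A, tail = bv, head = wv \<rparr>"
  define black where "black = bv ` A"
  define rot where "rot v = (if even v then a else b)" for v :: nat
  have Min_eq: "Min (orbit p e') = Min (orbit p e) \<longleftrightarrow> e' \<in> orbit p e"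
    if "perm_on A p" "e \<in> A" "e' \<in> A" for p e e'
    using that Min_in[OF finite_orbit_on orbit_nonempty] orbit_eq self_in_orbit by metis
  have bv: "{e' \<in> A. bv e' = bv e} = orbit a e" if "e \<in> A" for e
  proof -
    have "{e' \<in> A. bv e' = bv e} = {e' \<in> A. e' \<in> orbit a e}"
      unfolding bv_def using Min_eq[OF AD(1) that] by auto
    then show ?thesis using orbit_in[OF AD(1) that] by blast
  qed
  have wv: "{e' \<in> A. wv e' = wv e} = orbit b e" if "e \<in> A" for e
  proof -
    have "{e' \<in> A. wv e' = wv e} = {e' \<in> A. e' \<in> orbit b e}"
      unfolding wv_def using Min_eq[OF AD(2) that] by auto
    then show ?thesis using orbit_in[OF AD(2) that] by blast
  qed
  have even: "even (bv e)" "odd (wv e)" for e unfolding bv_def wv_def by simp_all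
  have cyc: "cyclic_on p (orbit p e)" if "perm_on A p" "e \<in> A" for p e
    using self_in_orbit[OF that] unfolding cyclic_on_def by blast
  have G: "verts G = bv ` A \<union> wv ` A" "arcs G = A" "tail G = bv" "head G = wv"
    unfolding G_def by simp_all
  have B: "perm_on A (\<lambda>e. rot (bv e) e)" "ctype A (\<lambda>e. rot (bv e) e)
      = image_mset (\<lambda>v. card {e \<in> A. bv e = v}) (mset_set (bv ` A))" "ncyc A (\<lambda>e. rot (bv e) e) = card (bv ` A)"
  proof -
    have cv: "cyclic_on (rot v) {e \<in> A. bv e = v}" if "v \<in> bv ` A" for v
      using that bv even cyc[OF AD(1)] by (auto simp: rot_def)
    show "perm_on A (\<lambda>e. rot (bv e) e)" "ctype A (\<lambda>e. rot (bv e) e)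
      = image_mset (\<lambda>v. card {e \<in> A. bv e = v}) (mset_set (bv ` A))"
      "ncyc A (\<lambda>e. rot (bv e) e) = card (bv ` A)"
      using vertex_rotation[of A bv "bv ` A" rot] AD(4) cv by blast+
  qed
  have W: "perm_on A (\<lambda>e. rot (wv e) e)" "ctype A (\<lambda>e. rot (wv e) e)
      = image_mset (\<lambda>v. card {e \<in> A. wv e = v}) (mset_set (wv ` A))" "ncyc A (\<lambda>e. rot (wv e) e) = card (wv ` A)"
  proof -
    have cv: "cyclic_on (rot v) {e \<in> A. wv e = v}" if "v \<in> wv ` A" for v
      using that wv even cyc[OF AD(2)] by (auto simp: rot_def)
    show "perm_on A (\<lambda>e. rot (wv e) e)" "ctype A (\<lambda>e. rot (wv e) e)
      = image_mset (\<lambda>v. card {e \<in> A. wv e = v}) (mset_set (wv ` A))"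
      "ncyc A (\<lambda>e. rot (wv e) e) = card (wv ` A)"
      using vertex_rotation[of A wv "wv ` A" rot] AD(4) cv by blast+
  qed
  have ab: "(\<lambda>e. rot (bv e) e) = a" "(\<lambda>e. rot (wv e) e) = b" unfolding rot_def using even by auto
  have F: "card (faces G rot) = ncyc A (a \<circ> b)"
    using faces_ctype(2)[of G rot] B(1) W(1) unfolding G ab by blast
  have n': "n = card A" using n(1) P(1) sum_ctype[OF AD(1)] by simp
  have disj: "bv ` A \<inter> wv ` A = {}" using even by (metis (no_types, lifting) disjoint_iff imageE)
  obtain e0 where e0: "e0 \<in> A" using AD(5) by blast
  let ?R = "rtrancl_on (verts G) ((arcs_ends G)\<^sup>s)"
  have edge: "(bv e, wv e) \<in> ?R" "(wv e, bv e) \<in> ?R" if "e \<in> A" for e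
  proof -
    have ends: "(bv e, wv e) \<in> (arcs_ends G)\<^sup>s" "(wv e, bv e) \<in> (arcs_ends G)\<^sup>s"
      using that unfolding symcl_def arcs_ends_conv G by auto
    have v: "bv e \<in> verts G" "wv e \<in> verts G" using that G by auto
    show "(bv e, wv e) \<in> ?R" by (rule converse_rtrancl_on_into_rtrancl_on[OF ends(1) _ v(1)]) (simp add: v)
    show "(wv e, bv e) \<in> ?R" by (rule converse_rtrancl_on_into_rtrancl_on[OF ends(2) _ v(2)]) (simp add: v)
  qed
  have bb: "(bv e, bv e') \<in> ?R" if "e \<in> A" "e' \<in> A" for e e'
    using A that
  proof (induction rule: constellation_induct)
    case base
    then show ?case using that G by (intro rtrancl_on_refl) auto
  next
    case (left y)
    have "bv (a y) = bv y" using bv[OF left(1)] orbit.base[of a y] by blast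
    then show ?case using left by simp
  next
    case (right y)
    have "wv (b y) = wv y" using wv[OF right(1)] orbit.base[of b y] by blast
    then have "(wv y, bv (b y)) \<in> ?R" using edge(2)[OF AD(7)[OF right(1)]] by simp
    then show ?case using right(2) edge(1)[OF right(1)] rtrancl_on_trans by metis
  qed
  have "(u, v) \<in> ?R" if "u \<in> verts G" "v \<in> verts G" for u v
  proof -
    obtain e where e: "e \<in> A" "u = bv e \<or> u = wv e" using \<open>u \<in> _\<close> G by auto
    obtain e' where e': "e' \<in> A" "v = bv e' \<or> v = wv e'" using \<open>v \<in> _\<close> G by auto
    have "(u, bv e) \<in> ?R" using e(2) edge(2)[OF e(1)] bb[OF e(1) e(1)] by blast
    moreover have "(bv e', v) \<in> ?R" using e'(2) edge(1)[OF e'(1)] bb[OF e'(1) e'(1)] by blast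
    ultimately show ?thesis using bb[OF e(1) e'(1)] rtrancl_on_trans by metis
  qed
  then have conn: "Digraph_Component.connected G"
    unfolding connected_conv using e0 G by auto
  have edges: "edges_at G (bv e) = orbit a e" "edges_at G (wv e) = orbit b e" if "e \<in> A" for e
    using bv[OF that] wv[OF that] even unfolding edges_at_def out_arcs_def in_arcs_def G
    by (metis (mono_tags, lifting) Collect_empty_eq Un_empty_right Un_empty_left)+
  have graph: "bicolored_graph G black rot"
  proof unfold_locales
    show "cyclic_on (rot v) (edges_at G v)" if "v \<in> verts G" for v
      using that edges cyc[OF AD(1)] cyc[OF AD(2)] even unfolding G rot_def by auto
    have "card (verts G) = card (bv ` A) + card (wv ` A)"
      unfolding G by (rule card_Un_disjoint) (use AD(4) disj in auto)
    moreover have "ncyc A a + ncyc A b + ncyc A (a \<circ> b) = card A + 2"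
      using n(2) P size_ctype n' by metis
    ultimately show "int (card (verts G)) - int (card (arcs G)) + int (card (faces G rot)) = 2"
      using B(3) W(3) F unfolding ab G by simp
    show "Digraph_Component.connected G" by (rule conn)
    show "arcs G \<noteq> {}" using AD(5) G by simp
    show "black \<subseteq> verts G" unfolding black_def G by blast
    show "tail G e \<in> black" if "e \<in> arcs G" for e using that unfolding black_def G by simp
    show "head G e \<notin> black" if "e \<in> arcs G" for e using that disj unfolding black_def G by blast
  qed (use AD(4) G in auto)
  then have "bicolored_graph.passport G black rot = (P1, P2, P3, n)"
    using bicolored_graph.graph_constellation(2)[OF graph] unfolding G ab P n' by simp
  then show thesis using graph that by blast
qed

section \<open>Platonic types and their number of edges\<close>

lemma realized_sums:
  assumes "realized P1 P2 P3"
  shows "sum_mset P2 = sum_mset P1" "sum_mset P3 = sum_mset P1"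
proof -
  obtain A :: "nat set" and a b where A: "constellation A a b"
    and P: "ctype A a = P1" "ctype A b = P2" "ctype A (a \<circ> b) = P3"
    using assms unfolding realized_def by blast
  show "sum_mset P2 = sum_mset P1" "sum_mset P3 = sum_mset P1"
    using sum_ctype constellationD(1-3)[OF A] P by metis+
qed

lemma platonic_realized_swap12: "platonic_realized k m l \<Longrightarrow> platonic_realized m k l"
proof -
  assume "platonic_realized k m l"
  then obtain p q r where pqr: "p + q + r = p * k + 2"
    and R: "realized (replicate_mset p k) (replicate_mset q m) (replicate_mset r l)"
    unfolding platonic_realized_def by blast
  have "q * m = p * k" using realized_sums(1)[OF R] by simp
  then show ?thesis using pqr realized_swap12[OF R] unfolding platonic_realized_def
    by (metis add.commute)
qed

lemma platonic_realized_swap23: "platonic_realized k m l \<Longrightarrow> platonic_realized k l m"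
  unfolding platonic_realized_def using realized_swap23 by (metis add.commute add.left_commute)

lemma platonic_iff_nat:
  "platonic k m l \<longleftrightarrow> k \<ge> 2 \<and> m \<ge> 2 \<and> l \<ge> 2 \<and> k * m * l < m * l + k * l + k * m"
proof (cases "k \<ge> 2 \<and> m \<ge> 2 \<and> l \<ge> 2")
  case True
  then have "1 / real k + 1 / real m + 1 / real l =
      real (m * l + k * l + k * m) / real (k * m * l)"
    by (simp add: field_simps)
  moreover have "real (k * m * l) > 0" using True by simp
  ultimately have "1 / real k + 1 / real m + 1 / real l > 1 \<longleftrightarrow>
      real (k * m * l) < real (m * l + k * l + k * m)"
    by (simp only: less_divide_eq_1_pos)
  then show ?thesis using True unfolding platonic_def by (simp only: of_nat_less_iff)
qed (auto simp: platonic_def)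

lemma platonic_swap: "platonic k m l \<Longrightarrow> platonic m k l" "platonic k m l \<Longrightarrow> platonic k l m"
  by (auto simp: platonic_def add_ac)

lemma platonic_sorted_cases:
  assumes P: "platonic k m l" and le: "k \<le> m" "m \<le> l"
  shows "k = 2 \<and> (m = 2 \<or> m = 3 \<and> l \<in> {3, 4, 5})"
proof -
  have P': "k \<ge> 2" "k * m * l < m * l + k * l + k * m" using P unfolding platonic_iff_nat by auto
  have "k * m \<le> m * l" "k * l \<le> m * l" using le by (simp_all add: mult_le_mono mult.commute)
  then have "k * (m * l) < 3 * (m * l)" using P'(2) unfolding mult.assoc by linarith
  then have k: "k = 2" using P'(1) by simp
  then have m1: "m * l < 2 * l + 2 * m" using P'(2) by (simp add: algebra_simps)
  also have "\<dots> \<le> 4 * l" using le by simp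
  finally have "m < 4" by simp
  then have "m = 2 \<or> m = 3" using le k by linarith
  moreover have "l \<in> {3, 4, 5}" if "m = 3" using m1 le that by auto
  ultimately show ?thesis using k by blast
qed

theorem platonic_exists:
  assumes "platonic k m l"
  shows "platonic_realized k m l"
proof -
  have sorted: "platonic_realized k m l" if "platonic k m l" "k \<le> m" "m \<le> l" for k m l
    using platonic_sorted_cases[OF that] that(1) platonic_dihedral platonic_tetrahedral
      platonic_octahedral platonic_icosahedral
    by (auto simp: platonic_def)
  note sw = platonic_swap platonic_realized_swap12 platonic_realized_swap23
  consider "k \<le> m" "m \<le> l" | "k \<le> l" "l \<le> m" | "m \<le> k" "k \<le> l" | "m \<le> l" "l \<le> k"
    | "l \<le> k" "k \<le> m" | "l \<le> m" "m \<le> k" by linarith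
  then show ?thesis
  proof cases
    case 1 then show ?thesis using sorted assms by blast
  next
    case 2 then show ?thesis using sorted[of k l m] sw assms by blast
  next
    case 3 then show ?thesis using sorted[of m k l] sw assms by blast
  next
    case 4 then show ?thesis using sorted[of m l k] sw assms by blast
  next
    case 5 then show ?thesis using sorted[of l k m] sw assms by blast
  next
    case 6 then show ?thesis using sorted[of l m k] sw assms by blast
  qed
qed

lemma regular_edge_count:
  assumes "k > 0" "m > 0" "l > 0" "p * k = n" "q * m = n" "r * l = n" "p + q + r = n + 2"
  shows "real n * (1 / real k + 1 / real m + 1 / real l - 1) = 2"
proof -
  have "real n / real k = real p" "real n / real m = real q" "real n / real l = real r"
    using assms by (auto simp: field_simps simp flip: of_nat_mult)
  moreover have "real p + real q + real r = real n + 2" using assms(7) by linarith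
  ultimately show ?thesis by (simp add: algebra_simps)
qed

text \<open>
  Euler's formula determines the number of edges by the type, which settles the uniqueness behind
  \<open>platonic_edges\<close>; existence is that of the Platonic constellation.
\<close>

lemma platonic_constellation:
  assumes "platonic k m l"
  obtains F :: "nat set" and a b where "constellation F a b"
    "\<And>x. x \<in> F \<Longrightarrow> card (orbit a x) = k" "\<And>x. x \<in> F \<Longrightarrow> card (orbit b x) = m"
    "\<And>x. x \<in> F \<Longrightarrow> card (orbit (a \<circ> b) x) = l"
    "card F = platonic_edges k m l" 
    "real (card F) * (1 / real k + 1 / real m + 1 / real l - 1) = 2"
proof -
  obtain p q r where pqr: "p + q + r = p * k + 2"
    and R: "realized (replicate_mset p k) (replicate_mset q m) (replicate_mset r l)"
    using platonic_exists[OF assms] unfolding platonic_realized_def by blast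
  obtain F :: "nat set" and a b where F: "constellation F a b"
    and P: "ctype F a = replicate_mset p k" "ctype F b = replicate_mset q m"
      "ctype F (a \<circ> b) = replicate_mset r l"
    using R unfolding realized_def by blast
  note FD = constellationD[OF F]
  have pos: "k > 0" "m > 0" "l > 0" using assms unfolding platonic_def by auto
  have sums: "p * k = card F" "q * m = card F" "r * l = card F"
    using sum_ctype[OF FD(1)] sum_ctype[OF FD(2)] sum_ctype[OF FD(3)] P by simp_all
  have len: "card (orbit c x) = L" if "ctype F c = replicate_mset t L" "x \<in> F" for c t L x
  proof -
    have "card (orbit c x) \<in># ctype F c" unfolding set_ctype[OF FD(4)] using that by blast
    then show ?thesis unfolding that(1) by (simp split: if_splits)
  qed
  have num: "real (card F) * (1 / real k + 1 / real m + 1 / real l - 1) = 2"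
    by (rule regular_edge_count[OF pos sums]) (use pqr sums in simp)
  have "platonic_edges k m l = card F"
    unfolding platonic_edges_def
  proof (rule the_equality)
    obtain G :: "(nat, nat) pre_digraph" and black rot where G: "bicolored_graph G black rot"
      "bicolored_graph.passport G black rot
        = (replicate_mset p k, replicate_mset q m, replicate_mset r l, card F)"
      by (rule realized_graph[OF R, of "card F"]) (use sums pqr in simp_all)
    then show "\<exists>(G :: (nat, nat) pre_digraph) black rot a b c. bicolored_graph G black rot \<and>
      bicolored_graph.passport G black rot =
        (replicate_mset a k, replicate_mset b m, replicate_mset c l, card F)" by blast
  next
    fix n
    assume "\<exists>(G :: (nat, nat) pre_digraph) black rot a b c. bicolored_graph G black rot \<and>
      bicolored_graph.passport G black rot =
        (replicate_mset a k, replicate_mset b m, replicate_mset c l, n)"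
    then obtain G :: "(nat, nat) pre_digraph" and black rot p' q' r' where
      G: "bicolored_graph G black rot" and pp: "bicolored_graph.passport G black rot =
        (replicate_mset p' k, replicate_mset q' m, replicate_mset r' l, n)" by blast
    let ?a = "\<lambda>e. rot (tail G e) e" and ?b = "\<lambda>e. rot (head G e) e"
    note gc = bicolored_graph.graph_constellation[OF G]
    note GD = constellationD[OF gc(1)]
    have ct: "ctype (arcs G) ?a = replicate_mset p' k" "ctype (arcs G) ?b = replicate_mset q' m"
      "ctype (arcs G) (?a \<circ> ?b) = replicate_mset r' l" "n = card (arcs G)"
      using gc(2) pp by simp_all
    have s: "p' * k = n" "q' * m = n" "r' * l = n"
      using sum_ctype[OF GD(1)] sum_ctype[OF GD(2)] sum_ctype[OF GD(3)] unfolding ct by simp_all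
    have "p' + q' + r' = n + 2"
      using gc(3) size_ctype[of "arcs G" ?a] size_ctype[of "arcs G" ?b]
        size_ctype[of "arcs G" "?a \<circ> ?b"] unfolding ct by simp
    then have "real n * (1 / real k + 1 / real m + 1 / real l - 1) = 2"
      by (rule regular_edge_count[OF pos s])
    then have "real n = real (card F)" using num by (metis mult_cancel_right mult_zero_right zero_neq_numeral)
    then show "n = card F" by simp
  qed
  then show thesis
    using that[OF F len[OF P(1)] len[OF P(2)] len[OF P(3)] _ num] by simp
qed

lemma platonic_edges_swap:
  assumes "platonic k m l"
  shows "platonic_edges m k l = platonic_edges k m l" "platonic_edges k l m = platonic_edges k m l"
proof -
  have e: "real (platonic_edges k m l) * (1 / real k + 1 / real m + 1 / real l - 1) = 2"
    if "platonic k m l" for k m l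
    using platonic_constellation[OF that] by metis
  have t: "1 / real k + 1 / real m + 1 / real l - 1 \<noteq> 0" using e[OF assms] by auto
  have "real (platonic_edges m k l) * (1 / real k + 1 / real m + 1 / real l - 1) = 2"
    "real (platonic_edges k l m) * (1 / real k + 1 / real m + 1 / real l - 1) = 2"
    using e[OF platonic_swap(1)[OF assms]] e[OF platonic_swap(2)[OF assms]] by (simp_all add: add_ac)
  then have "real (platonic_edges m k l) = real (platonic_edges k m l)"
    "real (platonic_edges k l m) = real (platonic_edges k m l)"
    using e[OF assms] t by (metis mult_cancel_right)+
  then show "platonic_edges m k l = platonic_edges k m l" "platonic_edges k l m = platonic_edges k m l"
    by simp_all
qed

text \<open>
  In a cyclic cover the cycle type is determined by the number \<open>n\<close> of ramified cycles.
\<close>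

lemma cover_ctype:
  fixes q :: "'a \<times> int \<Rightarrow> 'a \<times> int"
  assumes q: "perm_on (A \<times> {0..<int s}) q"
    and len: "\<And>z u. z \<in> A \<Longrightarrow> u \<in> {0..<int s} \<Longrightarrow>
      card (orbit q (z, u)) = L * (if z \<in> D then s else 1)"
    and D: "D \<subseteq> A" "card D = n * L" and L: "L > 0" and s: "s \<ge> 2"
  shows "\<exists>c. ctype (A \<times> {0..<int s}) q = replicate_mset c L + replicate_mset n (L * s)"
proof -
  let ?B = "A \<times> {0..<int s}" and ?M = "ctype (A \<times> {0..<int s}) q"
  have "{w \<in> ?B. card (orbit q w) = L * s} = D \<times> {0..<int s}"
    using len D(1) L s by (auto split: if_splits)
  then have "count ?M (L * s) * (L * s) = n * (L * s)"
    unfolding count_ctype[OF q] using D(2) by (simp add: card_cartesian_product)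
  then have n: "count ?M (L * s) = n" using L s by simp
  have "?M = replicate_mset (count ?M L) L + replicate_mset n (L * s)"
  proof (rule multiset_eqI)
    fix x
    have "x = L \<or> x = L * s" if "x \<in># ?M"
      using that len unfolding set_ctype[OF perm_on_finite[OF q]] by (auto split: if_splits)
    then have "count ?M x = 0" if "x \<noteq> L" "x \<noteq> L * s" using that by (meson not_in_iff)
    then show "count ?M x = count (replicate_mset (count ?M L) L + replicate_mset n (L * s)) x"
      using n L s by auto
  qed
  then show ?thesis by blast
qed

text \<open>
  Only the case of two faces needs an argument beyond the cyclic cover: there are at least two
  faces, since \<open>card F = l\<close> would force \<open>l (1/k + 1/m - 1) = 1\<close>, which is impossible for
  \<open>k, m \<ge> 2\<close>.
\<close>

theorem ramified_platonic_cover: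
  assumes P: "platonic k m l" and s: "s \<ge> 2" and n: "n = platonic_edges k m l * s"
  shows "\<exists>p q r. realized (replicate_mset p k) (replicate_mset q m)
      (replicate_mset r l + replicate_mset 2 (l * s)) \<and> p * k = n" (is ?two_faces)
    and "\<exists>p q r. realized (replicate_mset p k) (replicate_mset q m + replicate_mset 1 (m * s))
      (replicate_mset r l + replicate_mset 1 (l * s)) \<and> p * k = n" (is ?white_face)
proof -
  obtain F :: "nat set" and a b where F: "constellation F a b"
    and len: "\<And>x. x \<in> F \<Longrightarrow> card (orbit a x) = k" "\<And>x. x \<in> F \<Longrightarrow> card (orbit b x) = m"
      "\<And>x. x \<in> F \<Longrightarrow> card (orbit (a \<circ> b) x) = l"
    and cF: "card F = platonic_edges k m l"
    and num: "real (card F) * (1 / real k + 1 / real m + 1 / real l - 1) = 2"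
    using platonic_constellation[OF P] by metis
  note FD = constellationD[OF F]
  have klm: "k \<ge> 2" "m \<ge> 2" "l \<ge> 2" using P unfolding platonic_def by auto
  define L where "L t = (if t = 0 then k else if t = 1 then m else l)" for t :: nat
  have Lg: "card (orbit (gen a b t) z) = L t" if "z \<in> F" for t z
    using len that unfolding gen_def L_def by simp
  have Lpos: "L t > 0" for t using klm unfolding L_def by simp
  obtain x where x: "x \<in> F" using FD(5) by blast
  have go: "\<exists>c0 c1 c2. realized (replicate_mset c0 k + replicate_mset (f 0) (k * s))
      (replicate_mset c1 m + replicate_mset (f 1) (m * s))
      (replicate_mset c2 l + replicate_mset (f 2) (l * s)) \<and> c0 * k + f 0 * (k * s) = n"
    if y: "y \<in> F" and ij: "i < 3" "j < 3" and ne: "\<not> (i = j \<and> y \<in> orbit (gen a b i) x)"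
      and f: "\<And>t. t < 3 \<Longrightarrow> f t = of_bool (t = i) + of_bool (t = j)" for y i j f
  proof -
    obtain \<alpha> \<beta> where C: "constellation (F \<times> {0..<int s}) \<alpha> \<beta>"
      and cl: "\<And>t z u. t < 3 \<Longrightarrow> z \<in> F \<Longrightarrow> u \<in> {0..<int s} \<Longrightarrow>
       card (orbit (gen \<alpha> \<beta> t) (z, u)) = card (orbit (gen a b t) z) *
         (if t = i \<and> z \<in> orbit (gen a b i) x \<or> t = j \<and> z \<in> orbit (gen a b j) y then s else 1)"
      using cyclic_cover[OF F x y ij ne, of s] s by auto
    have ct: "\<exists>c. ctype (F \<times> {0..<int s}) (gen \<alpha> \<beta> t)
        = replicate_mset c (L t) + replicate_mset (f t) (L t * s)" if t: "t < 3" for t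
    proof -
      define X where "X = (if t = i then orbit (gen a b i) x else {})"
      define Y where "Y = (if t = j then orbit (gen a b j) y else {})"
      have XY: "X \<subseteq> F" "Y \<subseteq> F"
        unfolding X_def Y_def using orbit_in[OF perm_on_gen[OF F]] x y by auto
      have "X \<inter> Y = {}"
      proof (rule ccontr)
        assume "X \<inter> Y \<noteq> {}"
        then obtain z where "z \<in> X" "z \<in> Y" by blast
        then have z: "t = i" "t = j" "z \<in> orbit (gen a b i) x" "z \<in> orbit (gen a b i) y"
          unfolding X_def Y_def by (auto split: if_splits)
        then have "orbit (gen a b i) x = orbit (gen a b i) y"
          using orbit_eq[OF perm_on_gen[OF F]] x y by metis
        then show False using ne z(1,2) self_in_orbit[OF perm_on_gen[OF F] y] by auto
      qed
      moreover have "card X = of_bool (t = i) * L t" "card Y = of_bool (t = j) * L t"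
        unfolding X_def Y_def using Lg x y by auto
      ultimately have card: "card (X \<union> Y) = f t * L t"
        using card_Un_disjoint[of X Y] XY finite_subset FD(4) f[OF t] by (metis distrib_right)
      show ?thesis
        by (rule cover_ctype[OF perm_on_gen[OF C] _ _ card Lpos s])
          (use cl[OF t] Lg XY in \<open>auto simp: X_def Y_def\<close>)
    qed
    obtain c0 c1 c2 where c: "ctype (F \<times> {0..<int s}) \<alpha> = replicate_mset c0 k + replicate_mset (f 0) (k * s)"
      "ctype (F \<times> {0..<int s}) \<beta> = replicate_mset c1 m + replicate_mset (f 1) (m * s)"
      "ctype (F \<times> {0..<int s}) (\<alpha> \<circ> \<beta>) = replicate_mset c2 l + replicate_mset (f 2) (l * s)"
      using ct[of 0] ct[of 1] ct[of 2] by (auto simp: gen_def L_def)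
    have "c0 * k + f 0 * (k * s) = n"
      using sum_ctype[OF constellationD(1)[OF C]] unfolding c n cF[symmetric]
      by (simp add: card_cartesian_product)
    then show ?thesis using constellation_realized[OF C] unfolding c by blast
  qed
  have "\<exists>y\<in>F. y \<notin> orbit (a \<circ> b) x"
  proof (rule ccontr)
    assume "\<not> ?thesis"
    then have "orbit (a \<circ> b) x = F" using orbit_in[OF FD(3) x] by blast
    then have "card F = l" using len(3)[OF x] by simp
    then have "real l * (1 / real k + 1 / real m + 1 / real l - 1) = 2" using num by simp
    then have "real l * (1 / real k + 1 / real m - 1) = 1" using klm by (simp add: algebra_simps)
    moreover have "1 / real k \<le> 1 / 2" "1 / real m \<le> 1 / 2"
      using klm by (simp_all add: divide_simps)
    then have "real l * (1 / real k + 1 / real m - 1) \<le> 0" by (intro mult_nonneg_nonpos) auto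
    ultimately show False by linarith
  qed
  then obtain y where y: "y \<in> F" "y \<notin> orbit (gen a b 2) x" by (auto simp: gen_def)
  show ?two_faces
    using go[OF y(1), of 2 2 "\<lambda>t. if t = 2 then 2 else 0"] y(2) by auto
  show ?white_face
    using go[OF x, of 1 2 "\<lambda>t. if t = 0 then 0 else 1"] less_3_cases by fastforce
qed

section \<open>Passports of uniform 2-Platonic graphs\<close>

text \<open>
  The difference between \<open>n / k\<close> and the number of parts, to which only exceptional parts
  contribute; Euler's formula prescribes the sum of the three defects.
\<close>

lemma defect:
  fixes k :: nat
  assumes "k > 0"
  shows "real (sum_mset M) / real k - real (size M) = (\<Sum>x\<in>#{#x \<in># M. x \<noteq> k#}. real x / real k - 1)"
  using assms by (induction M) (auto simp: add_divide_distrib)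

lemma replicate_of_exceptions:
  assumes "\<And>x. x \<in># M \<Longrightarrow> x \<noteq> k \<Longrightarrow> x = y"
  shows "M = replicate_mset (count M k) k + replicate_mset (size {#x \<in># M. x \<noteq> k#}) y"
proof -
  have "set_mset {#x \<in># M. x \<noteq> k#} \<subseteq> {y}" using assms by auto
  then obtain c where "{#x \<in># M. x \<noteq> k#} = replicate_mset c y"
    using set_mset_subset_singletonD by metis
  moreover have "M = {#x \<in># M. x = k#} + {#x \<in># M. x \<noteq> k#}" by (rule multiset_partition)
  ultimately show ?thesis unfolding filter_eq_replicate_mset by (metis size_replicate_mset)
qed

lemma sum_mset_real_nonneg:
  fixes f :: "'a \<Rightarrow> real"
  assumes "\<And>x. x \<in># M \<Longrightarrow> 0 \<le> f x"
  shows "0 \<le> (\<Sum>x\<in>#M. f x)"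
  using assms by (induction M) auto

lemma sum_mset_nonneg_eq_0:
  fixes f :: "'a \<Rightarrow> real"
  assumes "\<And>x. x \<in># M \<Longrightarrow> 0 \<le> f x" "(\<Sum>x\<in>#M. f x) \<le> 0" "x \<in># M"
  shows "f x = 0"
  using assms
proof (induction M)
  case (add y M)
  have "0 \<le> (\<Sum>x\<in>#M. f x)" using add.prems(1) by (intro sum_mset_real_nonneg) auto
  moreover have "0 \<le> f y" using add.prems(1) by simp
  ultimately have "f y = 0" "(\<Sum>x\<in>#M. f x) \<le> 0" using add.prems(2) by simp_all
  then show ?case using add by auto
qed simp

text \<open>
  With \<open>N\<close> the degree of the lifting to the Platonic constellation, every exceptional part is at most
  \<open>N\<close> times its prescribed value, and the gaps \<open>N - x/h\<close> of the two exceptional parts add up to zero.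
\<close>

theorem uniform_exceptions:
  assumes E: "constellation E a b"
    and planar: "ncyc E a + ncyc E b + ncyc E (a \<circ> b) = card E + 2"
    and P: "ctype E a = P1" "ctype E b = P2" "ctype E (a \<circ> b) = P3"
    and klm: "k \<ge> 2" "m \<ge> 2" "l \<ge> 2"
    and dvd: "\<forall>x\<in>#P1. k dvd x" "\<forall>x\<in>#P2. m dvd x" "\<forall>x\<in>#P3. l dvd x"
    and two: "size {#x \<in># P1. x \<noteq> k#} + size {#x \<in># P2. x \<noteq> m#} + size {#x \<in># P3. x \<noteq> l#} = 2"
  obtains s p q r x1 x2 x3 where "platonic k m l" "s \<ge> 2" "card E = platonic_edges k m l * s"
    "x1 + x2 + x3 = (2 :: nat)" "P1 = replicate_mset p k + replicate_mset x1 (k * s)"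
    "P2 = replicate_mset q m + replicate_mset x2 (m * s)"
    "P3 = replicate_mset r l + replicate_mset x3 (l * s)"
proof -
  note ED = constellationD[OF E]
  define ex where "ex h M = {#x \<in># M. x \<noteq> h#}" for h :: nat and M
  define df where "df h M = (\<Sum>x\<in>#ex h M. real x / real h - 1)" for h M
  have parts: "x > 0" if "x \<in># ctype E c" "perm_on E c" for x c
    using that card_orbit_pos[OF that(2)] unfolding set_ctype[OF ED(4)] by auto
  have pos: "x > 0" if "x \<in># P1 \<or> x \<in># P2 \<or> x \<in># P3" for x
    using that parts ED(1-3) P by metis
  have ge: "real x / real h \<ge> 1" if "h dvd x" "x > 0" "h \<ge> 2" for x h :: nat
    using that dvd_imp_le[OF that(1,2)] by (simp add: le_divide_eq)
  have dfs: "df k P1 = real (card E) / real k - real (size P1)"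
    "df m P2 = real (card E) / real m - real (size P2)"
    "df l P3 = real (card E) / real l - real (size P3)"
  proof -
    have sums: "sum_mset P1 = card E" "sum_mset P2 = card E" "sum_mset P3 = card E"
      using sum_ctype[OF ED(1)] sum_ctype[OF ED(2)] sum_ctype[OF ED(3)] P by simp_all
    have "k > 0" "m > 0" "l > 0" using klm by simp_all
    then show "df k P1 = real (card E) / real k - real (size P1)"
      "df m P2 = real (card E) / real m - real (size P2)"
      "df l P3 = real (card E) / real l - real (size P3)"
      unfolding df_def ex_def
        defect[OF \<open>k > 0\<close>, symmetric] defect[OF \<open>m > 0\<close>, symmetric] defect[OF \<open>l > 0\<close>, symmetric]
        sums by simp_all
  qed
  have sizes: "real (size P1) + real (size P2) + real (size P3) = real (card E) + 2"
    using planar size_ctype[of E] P by (metis of_nat_add of_nat_numeral)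
  let ?\<chi> = "1 / real k + 1 / real m + 1 / real l - 1"
  have total: "df k P1 + df m P2 + df l P3 = real (card E) * ?\<chi> - 2"
    using dfs sizes by (simp add: algebra_simps)
  have df_nonneg: "0 \<le> df k P1" "0 \<le> df m P2" "0 \<le> df l P3"
    unfolding df_def using ge dvd pos klm by (auto simp: ex_def intro!: sum_mset_real_nonneg)
  have "real (card E) * ?\<chi> > 0" using total df_nonneg by linarith
  then have "?\<chi> > 0" by (simp add: zero_less_mult_iff)
  then have plat: "platonic k m l" unfolding platonic_def using klm by simp
  obtain F :: "nat set" and c d where F: "constellation F c d"
    and len: "\<And>x. x \<in> F \<Longrightarrow> card (orbit c x) = k" "\<And>x. x \<in> F \<Longrightarrow> card (orbit d x) = m"
      "\<And>x. x \<in> F \<Longrightarrow> card (orbit (c \<circ> d) x) = l"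
    and cF: "card F = platonic_edges k m l" and num: "real (card F) * ?\<chi> = 2"
    using platonic_constellation[OF plat] by metis
  have dvd': "k dvd card (orbit a x)" "m dvd card (orbit b x)" "l dvd card (orbit (a \<circ> b) x)"
    if "x \<in> E" for x
    using dvd that unfolding P[symmetric] set_ctype[OF ED(4)] by auto
  obtain N where N: "card E = N * card F" "\<And>x. x \<in> E \<Longrightarrow> card (orbit a x) \<le> N * k"
    "\<And>x. x \<in> E \<Longrightarrow> card (orbit b x) \<le> N * m" "\<And>x. x \<in> E \<Longrightarrow> card (orbit (a \<circ> b) x) \<le> N * l"
    by (rule planar_lifting_degree[OF E planar F len dvd']) auto
  have le: "\<forall>x\<in>#P1. x \<le> N * k" "\<forall>x\<in>#P2. x \<le> N * m" "\<forall>x\<in>#P3. x \<le> N * l"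
    using N(2-4) unfolding P[symmetric] set_ctype[OF ED(4)] by auto
  have total_N: "df k P1 + df m P2 + df l P3 = 2 * real N - 2"
  proof -
    have "real (card E) * ?\<chi> = real N * (real (card F) * ?\<chi>)" unfolding N(1) by simp
    then show ?thesis unfolding total num by simp
  qed
  have gap: "(\<Sum>x\<in>#ex h M. real N - real x / real h) = (real N - 1) * real (size (ex h M)) - df h M"
    for h M
  proof -
    have "(\<Sum>x\<in>#X. real N - real x / real h)
        = (real N - 1) * real (size X) - (\<Sum>x\<in>#X. real x / real h - 1)" for X
      by (induction X) (simp_all add: algebra_simps)
    then show ?thesis unfolding df_def .
  qed
  \<comment> \<open>These gaps are nonnegative, and counting cycles makes their sum zero.\<close>
  define gp where "gp h M = (\<Sum>x\<in>#ex h M. real N - real x / real h)" for h M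
  have gap_pos: "real N - real x / real h \<ge> 0" if "\<forall>x\<in>#M. x \<le> N * h" "x \<in># ex h M" "h \<ge> 2" for h M x
  proof -
    have "real x \<le> real N * real h" using that unfolding ex_def by (metis (no_types, lifting) mem_Collect_eq of_nat_le_iff of_nat_mult set_mset_filter)
    then show ?thesis using that(3) by (simp add: divide_le_eq)
  qed
  have gp_nonneg: "0 \<le> gp h M" if "\<forall>x\<in>#M. x \<le> N * h" "h \<ge> 2" for h M
    unfolding gp_def by (intro sum_mset_real_nonneg gap_pos[OF that(1) _ that(2)])
  have "real (size (ex k P1)) + real (size (ex m P2)) + real (size (ex l P3)) = 2"
    using two unfolding ex_def by (metis of_nat_add of_nat_numeral)
  then have "(real N - 1) * real (size (ex k P1)) + (real N - 1) * real (size (ex m P2))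
      + (real N - 1) * real (size (ex l P3)) = (real N - 1) * 2"
    by (metis distrib_left)
  then have "gp k P1 + gp m P2 + gp l P3 = 0"
    unfolding gp_def gap using total_N by (simp add: algebra_simps)
  then have "gp k P1 \<le> 0" "gp m P2 \<le> 0" "gp l P3 \<le> 0"
    using gp_nonneg[OF le(1) klm(1)] gp_nonneg[OF le(2) klm(2)] gp_nonneg[OF le(3) klm(3)] by linarith+
  then have exc: "x \<in># P1 \<Longrightarrow> x \<noteq> k \<Longrightarrow> x = k * N" "x \<in># P2 \<Longrightarrow> x \<noteq> m \<Longrightarrow> x = m * N"
    "x \<in># P3 \<Longrightarrow> x \<noteq> l \<Longrightarrow> x = l * N" for x
  proof -
    have *: "x = h * N" if "gp h M \<le> 0" "\<forall>x\<in>#M. x \<le> N * h" "h \<ge> 2" "x \<in># M" "x \<noteq> h" for h M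
    proof -
      have "real N - real x / real h = 0"
      proof (rule sum_mset_nonneg_eq_0[where M = "ex h M" and f = "\<lambda>x. real N - real x / real h"])
        show "(\<Sum>x\<in>#ex h M. real N - real x / real h) \<le> 0" using that(1) unfolding gp_def .
        show "x \<in># ex h M" using that(4,5) unfolding ex_def by simp
      qed (rule gap_pos[OF that(2) _ that(3)])
      then have "real x = real (h * N)" using that(3) by (simp add: field_simps)
      then show ?thesis by (simp only: of_nat_eq_iff)
    qed
    show "x \<in># P1 \<Longrightarrow> x \<noteq> k \<Longrightarrow> x = k * N" using *[OF \<open>gp k P1 \<le> 0\<close> le(1) klm(1)] .
    show "x \<in># P2 \<Longrightarrow> x \<noteq> m \<Longrightarrow> x = m * N" using *[OF \<open>gp m P2 \<le> 0\<close> le(2) klm(2)] .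
    show "x \<in># P3 \<Longrightarrow> x \<noteq> l \<Longrightarrow> x = l * N" using *[OF \<open>gp l P3 \<le> 0\<close> le(3) klm(3)] .
  qed
  have "N \<ge> 2"
  proof (rule ccontr)
    assume "\<not> N \<ge> 2"
    then have N: "N = 0 \<or> N = 1" by linarith
    have "x = h" if "x \<noteq> h \<Longrightarrow> x = h * N" "x > 0" for x h using that N by fastforce
    then have "\<And>x. x \<in># P1 \<Longrightarrow> x = k" "\<And>x. x \<in># P2 \<Longrightarrow> x = m" "\<And>x. x \<in># P3 \<Longrightarrow> x = l"
      using exc pos by metis+
    then have none: "{#x \<in># P1. x \<noteq> k#} = {#}" "{#x \<in># P2. x \<noteq> m#} = {#}"
      "{#x \<in># P3. x \<noteq> l#} = {#}" by auto
    show False using two unfolding none by simp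
  qed
  show thesis
    by (rule that[OF plat \<open>N \<ge> 2\<close> _ two replicate_of_exceptions replicate_of_exceptions
          replicate_of_exceptions]) (use exc N(1) cF in \<open>auto simp: mult.commute\<close>)
qed

text \<open>
  The right-hand side of the characterisation, named to be proved from several cases.
\<close>

definition two_platonic_form :: "nat multiset \<Rightarrow> nat multiset \<Rightarrow> nat multiset \<Rightarrow> nat \<Rightarrow> bool" where
  "two_platonic_form P1 P2 P3 n \<longleftrightarrow>
     (\<exists>Q1 Q2 Q3 k m l s.
        {#Q1, Q2, Q3#} = {#P1, P2, P3#} \<and> platonic k m l \<and> s \<ge> 2 \<and>
        n = platonic_edges k m l * s \<and>
        ((\<exists>a b c. Q1 = replicate_mset a k \<and> Q2 = replicate_mset b m \<and>
            Q3 = replicate_mset c l + {#l * s, l * s#}) \<or>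
         (\<exists>a b c. Q1 = replicate_mset a k \<and> Q2 = replicate_mset b m + {#m * s#} \<and>
            Q3 = replicate_mset c l + {#l * s#})))"

lemma two_platonic_formI:
  assumes Q: "{#Q1, Q2, Q3#} = {#P1, P2, P3#}" and P: "platonic k m l" and s: "s \<ge> 2"
    and n: "n = platonic_edges k m l * s"
    and Q1: "Q1 = replicate_mset a k" and Q2: "Q2 = replicate_mset b m + replicate_mset (2 - x) (m * s)"
    and Q3: "Q3 = replicate_mset c l + replicate_mset x (l * s)" and x: "x = 1 \<or> x = 2"
  shows "two_platonic_form P1 P2 P3 n"
proof -
  have "(\<exists>a b c. Q1 = replicate_mset a k \<and> Q2 = replicate_mset b m \<and>
            Q3 = replicate_mset c l + {#l * s, l * s#}) \<or>
         (\<exists>a b c. Q1 = replicate_mset a k \<and> Q2 = replicate_mset b m + {#m * s#} \<and>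
            Q3 = replicate_mset c l + {#l * s#})"
    using x
  proof
    assume "x = 1"
    then have "Q1 = replicate_mset a k \<and> Q2 = replicate_mset b m + {#m * s#} \<and>
            Q3 = replicate_mset c l + {#l * s#}" using Q1 Q2 Q3 by simp
    then show ?thesis by blast
  next
    assume "x = 2"
    then have "Q1 = replicate_mset a k \<and> Q2 = replicate_mset b m \<and>
            Q3 = replicate_mset c l + {#l * s, l * s#}" using Q1 Q2 Q3 by (simp add: numeral_2_eq_2)
    then show ?thesis by blast
  qed
  then show ?thesis unfolding two_platonic_form_def using Q P s n by blast
qed

text \<open>
  Two exceptions distributed over three partitions: the form asks for a partition without exception
  to come first, and for one with an exception to come last.
\<close>

lemma two_platonic_form_of_counts:
  assumes P: "platonic k m l" and s: "s \<ge> 2" and n: "n = platonic_edges k m l * s"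
    and x: "x1 + x2 + x3 = (2 :: nat)" and P1: "P1 = replicate_mset p k + replicate_mset x1 (k * s)"
    and P2: "P2 = replicate_mset q m + replicate_mset x2 (m * s)"
    and P3: "P3 = replicate_mset r l + replicate_mset x3 (l * s)"
  shows "two_platonic_form P1 P2 P3 n"
proof -
  have P': "platonic k l m" "platonic_edges k l m = platonic_edges k m l"
    "platonic m k l" "platonic_edges m k l = platonic_edges k m l"
    by (fact platonic_swap[OF P] platonic_edges_swap[OF P])+
  have "platonic m l k" "platonic_edges m l k = platonic_edges k m l"
    "platonic l k m" "platonic_edges l k m = platonic_edges k m l"
    by (fact platonic_swap(2)[OF P'(3)] trans[OF platonic_edges_swap(2)[OF P'(3)] P'(4)]
      platonic_swap(1)[OF P'(1)] trans[OF platonic_edges_swap(1)[OF P'(1)] P'(2)])+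
  note P' = P' this
  consider (1) "x1 = 0" "x3 \<noteq> 0" "x2 = 2 - x3" "x3 = 1 \<or> x3 = 2"
    | (2) "x1 = 0" "x2 = 2" "x3 = 0" | (3) "x2 = 0" "x3 = 2 - x1" "x1 = 1 \<or> x1 = 2"
    | (4) "x3 = 0" "x2 = 1" "x1 = 1"
  proof -
    have "x1 = 0 \<or> x1 = 1 \<or> x1 = 2" "x2 = 0 \<or> x2 = 1 \<or> x2 = 2" using x by linarith+
    then show ?thesis using x that by (elim disjE) simp_all
  qed
  then show ?thesis
  proof cases
    case 1
    show ?thesis
      by (rule two_platonic_formI[of P1 P2 P3 _ _ _ k m l s n p q x3 r]) (use 1 P s n P1 P2 P3 in simp_all)
  next
    case 2
    show ?thesis
      by (rule two_platonic_formI[of P1 P3 P2 _ _ _ k l m s n p r x2 q])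
        (use 2 P'(1,2) s n P1 P2 P3 in \<open>simp_all add: add_mset_commute\<close>)
  next
    case 3
    show ?thesis
      by (rule two_platonic_formI[of P2 P3 P1 _ _ _ m l k s n q r x1 p])
        (use 3 P'(5,6) s n P1 P2 P3 in \<open>simp_all add: add_mset_commute\<close>)
  next
    case 4
    show ?thesis
      by (rule two_platonic_formI[of P3 P1 P2 _ _ _ l k m s n r p x2 q])
        (use 4 P'(7,8) s n P1 P2 P3 in \<open>simp_all add: add_mset_commute\<close>)
  qed
qed

text \<open>
  Pairing each partition with its prescribed value makes the conditions invariant under simultaneous
  permutations of partitions and type.
\<close>

definition uniform_exceptional ::
    "nat \<times> nat multiset \<Rightarrow> nat \<times> nat multiset \<Rightarrow> nat \<times> nat multiset \<Rightarrow> bool" where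
  "uniform_exceptional = (\<lambda>(k, P1) (m, P2) (l, P3).
     realized P1 P2 P3 \<and> k \<ge> 2 \<and> m \<ge> 2 \<and> l \<ge> 2 \<and>
     (\<forall>x\<in>#P1. k dvd x) \<and> (\<forall>x\<in>#P2. m dvd x) \<and> (\<forall>x\<in>#P3. l dvd x) \<and>
     size {#x \<in># P1. x \<noteq> k#} + size {#x \<in># P2. x \<noteq> m#} + size {#x \<in># P3. x \<noteq> l#} = 2)"

lemma uniform_exceptional_swap:
  assumes "uniform_exceptional X Y Z"
  shows "uniform_exceptional Y X Z" "uniform_exceptional X Z Y"
proof -
  obtain k P1 m P2 l P3 where X: "X = (k, P1)" "Y = (m, P2)" "Z = (l, P3)"
    by (cases X, cases Y, cases Z)
  show "uniform_exceptional Y X Z" "uniform_exceptional X Z Y"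
    using assms realized_swap12[of P1 P2 P3] realized_swap23[of P1 P2 P3]
    unfolding uniform_exceptional_def X prod.case by simp_all
qed

lemma mset3_permutations:
  assumes "{#A, B, C#} = {#X, Y, Z#}"
  shows "(X, Y, Z) \<in> {(A, B, C), (A, C, B), (B, A, C), (B, C, A), (C, A, B), (C, B, A)}"
proof -
  have "X \<in># {#A, B, C#}" unfolding assms by simp
  then consider "X = A" "{#B, C#} = {#Y, Z#}" | "X = B" "{#A, C#} = {#Y, Z#}" | "X = C" "{#A, B#} = {#Y, Z#}"
  proof -
    have BC: "{#A, B, C#} = add_mset B {#A, C#}" "{#A, B, C#} = add_mset C {#A, B#}"
      by (simp_all add: add_mset_commute)
    have "X = A \<or> X = B \<or> X = C" using \<open>X \<in># _\<close> by simp
    then show thesis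
      using that assms BC by (metis add_mset_add_single add_mset_remove_trivial)
  qed
  then show ?thesis by cases (auto simp: add_eq_conv_ex)
qed

text \<open>
  The cyclic cover of a Platonic constellation has cycle types of the given form with possibly other
  multiplicities, but these are determined by the sum \<open>n\<close> of each partition.
\<close>

theorem realize_two_platonic_form:
  assumes "two_platonic_form P1 P2 P3 n"
    and n: "sum_mset P1 = n" "sum_mset P2 = n" "sum_mset P3 = n"
  shows "\<exists>k m l. uniform_exceptional (k, P1) (m, P2) (l, P3)"
proof -
  obtain Q1 Q2 Q3 k m l s where Q: "{#Q1, Q2, Q3#} = {#P1, P2, P3#}"
    and plat: "platonic k m l" and s: "s \<ge> 2" and ns: "n = platonic_edges k m l * s"
    and form: "(\<exists>a b c. Q1 = replicate_mset a k \<and> Q2 = replicate_mset b m \<and>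
            Q3 = replicate_mset c l + {#l * s, l * s#}) \<or>
         (\<exists>a b c. Q1 = replicate_mset a k \<and> Q2 = replicate_mset b m + {#m * s#} \<and>
            Q3 = replicate_mset c l + {#l * s#})"
    using assms(1) unfolding two_platonic_form_def by blast
  have klm: "k \<ge> 2" "m \<ge> 2" "l \<ge> 2" using plat unfolding platonic_def by auto
  note perm = mset3_permutations[OF Q]
  have sumQ: "sum_mset Q1 = n" "sum_mset Q2 = n" "sum_mset Q3 = n" using perm n by auto
  have Qex: "uniform_exceptional (k, Q1) (m, Q2) (l, Q3)"
    using form
  proof (elim disjE exE conjE)
    fix a b c assume Q: "Q1 = replicate_mset a k" "Q2 = replicate_mset b m"
      "Q3 = replicate_mset c l + {#l * s, l * s#}"
    obtain p q r where R: "realized (replicate_mset p k) (replicate_mset q m)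
      (replicate_mset r l + replicate_mset 2 (l * s))" and pn: "p * k = n"
      using ramified_platonic_cover(1)[OF plat s ns] by blast
    note RS = realized_sums[OF R]
    have "p = a" using pn sumQ(1) Q(1) klm by auto
    moreover have "q = b" using RS(1) pn sumQ(2) Q(2) klm by auto
    moreover have "r = c" using RS(2) pn sumQ(3) Q(3) klm by (auto simp: numeral_2_eq_2)
    ultimately have "realized Q1 Q2 Q3" using R Q by (simp add: numeral_2_eq_2)
    then show ?thesis unfolding uniform_exceptional_def using klm s Q by auto
  next
    fix a b c assume Q: "Q1 = replicate_mset a k" "Q2 = replicate_mset b m + {#m * s#}"
      "Q3 = replicate_mset c l + {#l * s#}"
    obtain p q r where R: "realized (replicate_mset p k) (replicate_mset q m + replicate_mset 1 (m * s))
      (replicate_mset r l + replicate_mset 1 (l * s))" and pn: "p * k = n"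
      using ramified_platonic_cover(2)[OF plat s ns] by blast
    note RS = realized_sums[OF R]
    have "p = a" using pn sumQ(1) Q(1) klm by auto
    moreover have "q = b" using RS(1) pn sumQ(2) Q(2) klm by auto
    moreover have "r = c" using RS(2) pn sumQ(3) Q(3) klm by auto
    ultimately have "realized Q1 Q2 Q3" using R Q by simp
    then show ?thesis unfolding uniform_exceptional_def using klm s Q by auto
  qed
  note sw = uniform_exceptional_swap
  have all: "uniform_exceptional (k, Q1) (l, Q3) (m, Q2)" "uniform_exceptional (m, Q2) (k, Q1) (l, Q3)"
    "uniform_exceptional (m, Q2) (l, Q3) (k, Q1)" "uniform_exceptional (l, Q3) (k, Q1) (m, Q2)"
    "uniform_exceptional (l, Q3) (m, Q2) (k, Q1)"
    using Qex sw by meson+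
  show ?thesis using perm Qex all by auto
qed

theorem corollary7p2:
  fixes P1 P2 P3 :: "nat multiset" and n :: nat
  assumes "is_passport (P1, P2, P3, n)"
  shows
    "(\<exists>(G :: (nat, nat) pre_digraph) black rot k m l.
        bicolored_graph G black rot \<and>
        bicolored_graph.passport G black rot = (P1, P2, P3, n) \<and>
        bicolored_graph.two_platonic G black rot k m l \<and>
        bicolored_graph.uniform G black rot k m l)
     \<longleftrightarrow>
     (\<exists>Q1 Q2 Q3 k m l s.
        {#Q1, Q2, Q3#} = {#P1, P2, P3#} \<and> platonic k m l \<and> s \<ge> 2 \<and>
        n = platonic_edges k m l * s \<and>
        ((\<exists>a b c. Q1 = replicate_mset a k \<and> Q2 = replicate_mset b m \<and>
            Q3 = replicate_mset c l + {#l * s, l * s#}) \<or>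
         (\<exists>a b c. Q1 = replicate_mset a k \<and> Q2 = replicate_mset b m + {#m * s#} \<and>
            Q3 = replicate_mset c l + {#l * s#})))"
  (is "?graph \<longleftrightarrow> ?form")
proof
  assume ?graph
  then obtain G :: "(nat, nat) pre_digraph" and black rot k m l where
    G: "bicolored_graph G black rot"
    and pp: "bicolored_graph.passport G black rot = (P1, P2, P3, n)"
    and tp: "bicolored_graph.two_platonic G black rot k m l"
    and un: "bicolored_graph.uniform G black rot k m l" by blast
  let ?a = "\<lambda>e. rot (tail G e) e" and ?b = "\<lambda>e. rot (head G e) e"
  note gc = bicolored_graph.graph_constellation[OF G]
  have P: "ctype (arcs G) ?a = P1" "ctype (arcs G) ?b = P2" "ctype (arcs G) (?a \<circ> ?b) = P3"
    and n: "card (arcs G) = n"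
    using gc(2) pp by simp_all
  have parts: "bicolored_graph.black_partition G black = P1"
    "bicolored_graph.white_partition G black = P2" "bicolored_graph.face_partition G rot = P3"
    using pp unfolding bicolored_graph.passport_def[OF G] by simp_all
  have klm: "k \<ge> 2" "m \<ge> 2" "l \<ge> 2"
    and dvd: "\<forall>x\<in>#P1. k dvd x" "\<forall>x\<in>#P2. m dvd x" "\<forall>x\<in>#P3. l dvd x"
    using un unfolding bicolored_graph.uniform_def[OF G] parts by auto
  have two: "size {#x \<in># P1. x \<noteq> k#} + size {#x \<in># P2. x \<noteq> m#} + size {#x \<in># P3. x \<noteq> l#} = 2"
    using tp unfolding bicolored_graph.two_platonic_def[OF G] parts by blast
  obtain s p q r x1 x2 x3 where "platonic k m l" "s \<ge> 2" "card (arcs G) = platonic_edges k m l * s"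
    "x1 + x2 + x3 = (2 :: nat)" "P1 = replicate_mset p k + replicate_mset x1 (k * s)"
    "P2 = replicate_mset q m + replicate_mset x2 (m * s)"
    "P3 = replicate_mset r l + replicate_mset x3 (l * s)"
    by (rule uniform_exceptions[OF gc(1,3) P klm dvd two])
  then have "two_platonic_form P1 P2 P3 n"
    unfolding n by (rule two_platonic_form_of_counts)
  then show ?form unfolding two_platonic_form_def .
next
  assume ?form
  then have form: "two_platonic_form P1 P2 P3 n" unfolding two_platonic_form_def .
  have n: "sum_mset P1 = n" "sum_mset P2 = n" "sum_mset P3 = n"
    and sizes: "size P1 + size P2 + size P3 = n + 2"
    using assms by (auto simp: is_partition_def)
  obtain k m l where U: "uniform_exceptional (k, P1) (m, P2) (l, P3)"
    using realize_two_platonic_form[OF form n] by blast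
  have R: "realized P1 P2 P3" and klm: "k \<ge> 2" "m \<ge> 2" "l \<ge> 2"
    and dvd: "\<forall>x\<in>#P1. k dvd x" "\<forall>x\<in>#P2. m dvd x" "\<forall>x\<in>#P3. l dvd x"
    and two: "size {#x \<in># P1. x \<noteq> k#} + size {#x \<in># P2. x \<noteq> m#} + size {#x \<in># P3. x \<noteq> l#} = 2"
    using U unfolding uniform_exceptional_def by auto
  obtain G :: "(nat, nat) pre_digraph" and black rot where
    G: "bicolored_graph G black rot"
    and pp: "bicolored_graph.passport G black rot = (P1, P2, P3, n)"
    by (rule realized_graph[OF R n(1)[symmetric] sizes])
  have parts: "bicolored_graph.black_partition G black = P1"
    "bicolored_graph.white_partition G black = P2" "bicolored_graph.face_partition G rot = P3"
    using pp unfolding bicolored_graph.passport_def[OF G] by simp_all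
  have un: "bicolored_graph.uniform G black rot k m l"
    unfolding bicolored_graph.uniform_def[OF G] parts using klm dvd by simp
  have "bicolored_graph.two_platonic G black rot k m l"
    unfolding bicolored_graph.two_platonic_def[OF G] parts
  proof (intro conjI klm two notI)
    assume "\<exists>r t. r \<ge> 2 \<and> \<not> t dvd r \<and> {#(k, P1), (m, P2), (l, P3)#} =
        {#(2, replicate_mset r 2), (2, replicate_mset r 2), (t, replicate_mset 2 r)#}"
    then obtain r t where rt: "\<not> t dvd r" "{#(k, P1), (m, P2), (l, P3)#} =
        {#(2, replicate_mset r 2), (2, replicate_mset r 2), (t, replicate_mset 2 r)#}" by blast
    \<comment> \<open>Uniformity makes \<open>t\<close> divide the part \<open>r\<close> of its own partition.\<close>
    have "(t, replicate_mset 2 r) \<in># {#(k, P1), (m, P2), (l, P3)#}" unfolding rt(2) by simp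
    then have "\<forall>x\<in>#replicate_mset 2 r. t dvd x" using dvd by auto
    then show False using rt(1) by simp
  qed
  then show ?graph using G pp un by blast
qed

end
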